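(* Let $N_A,N_R,N_B$ be integers with $N_A\ge 1$, $N_R\ge 0$, $N_B\ge 1$, and $N=N_A+N_R+N_B$. Consider a chain of $N$ qubits with Hilbert space $(\mathbb{C}^2)^{\otimes N}$, divided into $A$ (qubits $1,\dots,N_A$), $R$ (the next $N_R$ qubits) and $B$ (the last $N_B$ qubits). Let $H$ be a Hermitian operator on $(\mathbb{C}^2)^{\otimes N}$ of the form $H=\sum_{n=1}^{N}h_n+\sum_{n=1}^{N-1}h_{n,n+1}$, where $h_n$ acts only on qubit $n$ and $h_{n,n+1}$ acts only on qubits $n,n+1$, and suppose $H$ conserves the number of excitations, i.e. $[H,\sum_{n=1}^N Z_n]=0$. Let $|\boldsymbol{0}\rangle=|0\rangle^{\otimes N}$, $|\boldsymbol{n}\rangle=X_n|\boldsymbol{0}\rangle$, and assume there is a time $t_0$ with $f_{1,N}(t_0)\equiv\langle\boldsymbol{N}|e^{-iHt_0}|\boldsymbol{1}\rangle\neq 0$. For $t>0$ and an integer $L\ge 1$, let the memory $M=M_1\otimes\cdots\otimes M_L$ consist of $L$ registers of $N_B$ qubits each, initialised in $|0\rangle_M=|0\rangle^{\otimes N_BL}$. Let $U=e^{-iHt}\otimes 1_M$, let $S_\ell$ be the unitary that swaps the $N_B$ qubits of $B$ with the $N_B$ qubits of $M_\ell$ (qubit by qubit), and set $W=S_LUS_{L-1}U\cdots S_1U$. Then for every $\epsilon>0$ there exist $t>0$, $L\ge 1$ and an isometry $E:(\mathbb{C}^2)^{\otimes N_A}\to\mathcal{H}_M$ such that for every unit vector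 $|\psi\rangle_A\in(\mathbb{C}^2)^{\otimes N_A}$, $$\langle\psi|_A\,E^{\dagger}\,\rho_M\,E\,|\psi\rangle_A\ \ge\ 1-\epsilon,\qquad \rho_M=\mathrm{Tr}_{\text{chain}}\Big[W\big(|\Psi\rangle\langle\Psi|\otimes|0\rangle_M\langle0|\big)W^{\dagger}\Big],$$ where $|\Psi\rangle=|\psi\rangle_A\otimes|0\rangle^{\otimes(N_R+N_B)}$ and $\mathrm{Tr}_{\text{chain}}$ is the partial trace over the $N$ chain qubits.
   Context: $X_n,Z_n$ denote the Pauli $X$ and $Z$ matrices acting on qubit $n$; $|0\rangle,|1\rangle$ is the computational basis of a qubit (with $Z|0\rangle=|0\rangle$). An "excitation" is a qubit in state $|1\rangle$. *)

theory Defs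
  imports Complex_Main "Jordan_Normal_Form.Matrix"
begin

text \<open>Conventions. A register of T qubits has Hilbert space C^(2^T), with computational
basis indexed by x < 2^T; qubit q (1-based, q = 1..T) of the basis state x is the bit
(x div 2^(T-q)) mod 2, i.e. qubit 1 is the most significant one. This matches the
Kronecker product ordering below (left factor = more significant).\<close>

definition kron :: "complex mat \<Rightarrow> complex mat \<Rightarrow> complex mat" where
  "kron A B = mat (dim_row A * dim_row B) (dim_col A * dim_col B)
     (\<lambda>(i,j). A $$ (i div dim_row B, j div dim_col B) * B $$ (i mod dim_row B, j mod dim_col B))"

definition adj :: "complex mat \<Rightarrow> complex mat" where
  "adj A = transpose_mat (map_mat cnj A)"

definition mexp :: "complex mat \<Rightarrow> complex mat" where
  "mexp A = mat (dim_row A) (dim_col A)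
     (\<lambda>(i,j). \<Sum>k. (A ^\<^sub>m k) $$ (i,j) / of_nat (fact k))"

definition msum :: "nat \<Rightarrow> ('i \<Rightarrow> complex mat) \<Rightarrow> 'i set \<Rightarrow> complex mat" where
  "msum D F S = mat D D (\<lambda>ij. \<Sum>n\<in>S. F n $$ ij)"

definition embed1 :: "nat \<Rightarrow> nat \<Rightarrow> complex mat \<Rightarrow> complex mat" where
  "embed1 N n a = kron (kron (1\<^sub>m (2^(n-1))) a) (1\<^sub>m (2^(N-n)))"

definition embed2 :: "nat \<Rightarrow> nat \<Rightarrow> complex mat \<Rightarrow> complex mat" where
  "embed2 N n b = kron (kron (1\<^sub>m (2^(n-1))) b) (1\<^sub>m (2^(N-n-1)))"

definition pauliZ :: "complex mat" where
  "pauliZ = mat 2 2 (\<lambda>(i,j). if i = j then (if i = 0 then 1 else -1) else 0)"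

definition Ztot :: "nat \<Rightarrow> complex mat" where
  "Ztot N = msum (2^N) (\<lambda>n. embed1 N n pauliZ) {1..N}"

definition nn_form :: "nat \<Rightarrow> complex mat \<Rightarrow> bool" where
  "nn_form N H \<longleftrightarrow> (\<exists>a b. (\<forall>n. a n \<in> carrier_mat 2 2) \<and> (\<forall>n. b n \<in> carrier_mat 4 4) \<and>
     H = msum (2^N) (\<lambda>n. embed1 N n (a n)) {1..N} + msum (2^N) (\<lambda>n. embed2 N n (b n)) {1..<N})"

definition hermitian_mat :: "nat \<Rightarrow> complex mat \<Rightarrow> bool" where
  "hermitian_mat D H \<longleftrightarrow> H \<in> carrier_mat D D \<and> adj H = H"

definition evol :: "complex mat \<Rightarrow> real \<Rightarrow> complex mat" where
  "evol H t = mexp ((- \<i> * complex_of_real t) \<cdot>\<^sub>m H)"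

text \<open>f_{1,N}(t) = <N| e^{-iHt} |1>; |n> = X_n|0...0> is the basis state 2^(N-n)\<close>
definition f1N :: "nat \<Rightarrow> complex mat \<Rightarrow> real \<Rightarrow> complex" where
  "f1N N H t = evol H t $$ (2^(N-N), 2^(N-1))"

text \<open>unitary permuting qubits of a T-qubit register: qubit q of the output basis state
equals qubit (\<sigma> q) of the input basis state\<close>
definition qubit_perm_mat :: "nat \<Rightarrow> (nat \<Rightarrow> nat) \<Rightarrow> complex mat" where
  "qubit_perm_mat T \<sigma> = mat (2^T) (2^T)
     (\<lambda>(i,j). if i = (\<Sum>q\<in>{1..T}. ((j div 2^(T - \<sigma> q)) mod 2) * 2^(T-q)) then 1 else 0)"

text \<open>S_l: swaps chain qubits N-NB+k with memory qubits N+(l-1)NB+k (k=1..NB), in the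
register of N + NB*L qubits (chain first, then M_1, ..., M_L)\<close>
definition swap_sigma :: "nat \<Rightarrow> nat \<Rightarrow> nat \<Rightarrow> nat \<Rightarrow> nat" where
  "swap_sigma N NB l q =
     (if N - NB < q \<and> q \<le> N then q + l * NB
      else if N + (l-1)*NB < q \<and> q \<le> N + l*NB then q - l * NB else q)"

definition Sop :: "nat \<Rightarrow> nat \<Rightarrow> nat \<Rightarrow> nat \<Rightarrow> complex mat" where
  "Sop N NB L l = qubit_perm_mat (N + NB*L) (swap_sigma N NB l)"

definition Uop :: "nat \<Rightarrow> nat \<Rightarrow> nat \<Rightarrow> complex mat \<Rightarrow> real \<Rightarrow> complex mat" where
  "Uop N NB L H t = kron (evol H t) (1\<^sub>m (2^(NB*L)))"

primrec Wseq :: "nat \<Rightarrow> (nat \<Rightarrow> complex mat) \<Rightarrow> complex mat \<Rightarrow> nat \<Rightarrow> complex mat" where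
  "Wseq D S U 0 = 1\<^sub>m D"
| "Wseq D S U (Suc l) = S (Suc l) * U * Wseq D S U l"

definition Wop :: "nat \<Rightarrow> nat \<Rightarrow> nat \<Rightarrow> complex mat \<Rightarrow> real \<Rightarrow> complex mat" where
  "Wop N NB L H t = Wseq (2^(N + NB*L)) (Sop N NB L) (Uop N NB L H t) L"

text \<open>|psi>_A \<otimes> |0...0> on the remaining N - NA chain qubits and the NB*L memory qubits\<close>
definition init_state :: "nat \<Rightarrow> nat \<Rightarrow> complex vec \<Rightarrow> complex vec" where
  "init_state NA T \<psi> = vec (2^T) (\<lambda>i. if i mod 2^(T-NA) = 0 then \<psi> $ (i div 2^(T-NA)) else 0)"

definition proj :: "complex vec \<Rightarrow> complex mat" where
  "proj v = mat (dim_vec v) (dim_vec v) (\<lambda>(i,j). v $ i * cnj (v $ j))"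

definition ptrace_first :: "nat \<Rightarrow> nat \<Rightarrow> complex mat \<Rightarrow> complex mat" where
  "ptrace_first DC DM \<rho> = mat DM DM (\<lambda>(i,j). \<Sum>c<DC. \<rho> $$ (c*DM + i, c*DM + j))"

definition rhoM :: "nat \<Rightarrow> nat \<Rightarrow> nat \<Rightarrow> complex mat \<Rightarrow> real \<Rightarrow> nat \<Rightarrow> complex vec \<Rightarrow> complex mat" where
  "rhoM NA NR NB H t L \<psi> =
    (let N = NA + NR + NB; T = N + NB*L; W = Wop N NB L H t in
     ptrace_first (2^N) (2^(NB*L)) (W * proj (init_state NA T \<psi>) * adj W))"

definition isometry :: "nat \<Rightarrow> nat \<Rightarrow> complex mat \<Rightarrow> bool" where
  "isometry Din Dout E \<longleftrightarrow> E \<in> carrier_mat Dout Din \<and> adj E * E = 1\<^sub>m Din"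

definition is_unit_vec :: "nat \<Rightarrow> complex vec \<Rightarrow> bool" where
  "is_unit_vec D v \<longleftrightarrow> v \<in> carrier_vec D \<and> (\<Sum>i<D. (cmod (v $ i))\<^sup>2) = 1"

definition expect :: "complex mat \<Rightarrow> complex vec \<Rightarrow> complex" where
  "expect A v = (\<Sum>i<dim_vec v. \<Sum>j<dim_vec v. cnj (v $ i) * A $$ (i,j) * v $ j)"

end

theory Submission
  imports Defs "HOL-Analysis.Derivative"
begin

text \<open>One round (evolve, swap \<open>B\<close> into a fresh memory register) acts on the chain through the Kraus
  operators \<open>(1 \<otimes> |0><b|) U\<close>, and the expected number of excitations left in the chain never
  increases. If it did not decrease during \<open>N\<close> rounds, then \<open>U^m v\<close> would have no excitation in \<open>B\<close>
  for all \<open>m \<le> N\<close>; for a suitable small \<open>t\<close> this forces \<open>v\<close> to be a multiple of the ground state. Indeed, as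
  \<open>t\<close> tends to 0 the vectors \<open>((U - 1) / t)^k v\<close> tend to \<open>(-iH)^k v\<close>, and if no \<open>H^k v\<close> is excited on the last
  \<open>j\<close> qubits then, since \<open>f1N \<noteq> 0\<close> makes every nearest-neighbour hopping amplitude nonzero, none is excited on
  the last \<open>j + 1\<close> qubits either. By compactness the excitation number contracts by a
  fixed factor every \<open>N\<close> rounds, so the chain is emptied and the map from \<open>A\<close> to the memory is
  nearly isometric; Gram-Schmidt replaces it by a nearby isometry \<open>E\<close>.\<close>

section \<open>Finite sums, subsequences and binary weights\<close>

text \<open>The excitation number serves as a Lyapunov function because it misses only the ground
  state: every other basis state has weight at least 1. A small residual therefore puts almost all
  amplitude on the empty chain, and unitarity then makes the memory amplitudes of different inputs
  nearly orthonormal.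

  Contraction cannot be asked for in every single round, since an excitation may need several steps
  to reach \<open>B\<close>; and it may fail at special times, where \<open>U\<close> can act
  trivially on parts of the state space. Taking \<open>t\<close> small replaces a spectral analysis
  of the channel: powers of \<open>U\<close> then expose powers of \<open>H\<close>. The bad vector
  may change with \<open>t\<close>, which costs one compactness argument; a second one makes the
  strict decrease uniform. Neither is quantitative, but \<open>t\<close> is chosen independently of
  \<epsilon>, and only \<open>L\<close> has to adapt to it.

  The order of choices matters: the Gram-Schmidt tolerance is fixed before \<open>L\<close>, yet the
  memory dimension grows with \<open>L\<close>. Hence the perturbation lemma has to be uniform in
  the dimension.\<close>

lemma sum_lessThan_mult:
  fixes f :: "nat \<Rightarrow> 'a::comm_monoid_add"
  shows "(\<Sum>x<m * k. f x) = (\<Sum>a<m. \<Sum>b<k. f (a * k + b))"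
proof -
  have "(\<Sum>x\<in>{a * k..<a * k + k}. f x) = (\<Sum>b<k. f (a * k + b))" for a
    by (rule sum.reindex_bij_witness[of _ "\<lambda>b. a * k + b" "\<lambda>x. x - a * k"]) auto
  then show ?thesis
    by (simp flip: sum.nat_group)
qed

lemma mult_add_less_mult:
  fixes a b m k :: nat
  assumes "a < m" "b < k"
  shows "a * k + b < m * k"
proof -
  have "a * k + b < a * k + k" using assms(2) by simp
  also have "\<dots> = Suc a * k" by simp
  also have "\<dots> \<le> m * k" using assms(1) by (intro mult_le_mono1) simp
  finally show ?thesis .
qed

text \<open>Bolzano-Weierstrass in dimension \<open>D\<close>, for vectors encoded as functions of
  which only the first \<open>D\<close> values matter. Refining the subsequence one coordinate at a
  time suffices, as \<open>D\<close> is finite.\<close>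

lemma convergent_subsequence_pointwise:
  fixes v :: "nat \<Rightarrow> nat \<Rightarrow> 'a::heine_borel"
  assumes "\<And>x. x < D \<Longrightarrow> bounded (range (\<lambda>j. v j x))"
  shows "\<exists>r l. strict_mono (r::nat\<Rightarrow>nat) \<and> (\<forall>x<D. (\<lambda>j. v (r j) x) \<longlonglongrightarrow> l x)"
  using assms
proof (induction D)
  case 0
  show ?case using strict_mono_id by auto
next
  case (Suc D)
  then obtain r l where r: "strict_mono (r::nat\<Rightarrow>nat)" "\<And>x. x < D \<Longrightarrow> (\<lambda>j. v (r j) x) \<longlonglongrightarrow> l x"
    by auto
  have "bounded (range (\<lambda>j. v (r j) D))"
    by (rule bounded_subset[OF Suc.prems[of D]]) auto
  then obtain l' r' where r': "strict_mono (r'::nat\<Rightarrow>nat)" "((\<lambda>j. v (r j) D) \<circ> r') \<longlonglongrightarrow> l'"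
    using bounded_imp_convergent_subsequence by blast
  have "(\<lambda>j. v ((r \<circ> r') j) x) \<longlonglongrightarrow> (l(D := l')) x" if "x < Suc D" for x
  proof (cases "x = D")
    case True
    then show ?thesis using r'(2) by (simp add: o_def)
  next
    case False
    then show ?thesis
      using that LIMSEQ_subseq_LIMSEQ[OF r(2) r'(1), of x] by (simp add: o_def)
  qed
  moreover have "strict_mono (r \<circ> r')" using r(1) r'(1) by (rule strict_mono_o)
  ultimately show ?case by blast
qed

text \<open>The binary digit sum, that is, the number of excitations in basis state
  \<open>x\<close>. As a simplification rule the defining equation would unfold forever.\<close>

fun wt :: "nat \<Rightarrow> nat" where
  "wt x = (if x = 0 then 0 else x mod 2 + wt (x div 2))"

declare wt.simps [simp del]

lemma wt_0 [simp]: "wt 0 = 0"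
  by (simp add: wt.simps)

lemma wt_Suc_0 [simp]: "wt (Suc 0) = 1"
  by (simp add: wt.simps)

lemma wt_div2: "wt x = x mod 2 + wt (x div 2)"
  by (cases "x = 0") (simp_all add: wt.simps)

lemma wt_mult_power2_add: "b < 2 ^ m \<Longrightarrow> wt (a * 2 ^ m + b) = wt a + wt b"
proof (induction m arbitrary: b)
  case (Suc m)
  have "wt (a * 2 ^ Suc m + b) = b mod 2 + wt (a * 2 ^ m + b div 2)"
  proof -
    have "a * 2 ^ Suc m + b = b + 2 * (a * 2 ^ m)" by simp
    then have "(a * 2 ^ Suc m + b) mod 2 = b mod 2" "(a * 2 ^ Suc m + b) div 2 = a * 2 ^ m + b div 2"
      by (simp_all only: mod_mult_self2 div_mult_self2 zero_neq_numeral not_False_eq_True)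
    then show ?thesis by (simp only: wt_div2[of "a * 2 ^ Suc m + b"])
  qed
  also have "\<dots> = wt a + (b mod 2 + wt (b div 2))"
    using Suc by (simp add: less_mult_imp_div_less)
  finally show ?case by (simp flip: wt_div2)
qed simp

lemma wt_power2 [simp]: "wt (2 ^ m) = 1"
  using wt_mult_power2_add[of 0 m 1] by simp

lemma wt_eq_0_iff [simp]: "wt x = 0 \<longleftrightarrow> x = 0"
proof (induction x rule: wt.induct)
  case (1 x)
  then show ?case by (cases "x = 0") (auto simp: wt.simps[of x])
qed

lemma wt_eq_1_imp_power2: "wt x = 1 \<Longrightarrow> \<exists>i. x = 2 ^ i"
proof (induction x rule: wt.induct)
  case (1 x)
  then have x0: "x \<noteq> 0" by (metis wt_0 zero_neq_one)
  show ?case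
  proof (cases "even x")
    case True
    then have "wt (x div 2) = 1" using "1.prems" by (simp add: wt_div2[of x])
    then obtain i where "x div 2 = 2 ^ i" using "1.IH" x0 by blast
    then have "x = 2 ^ Suc i" using True by auto
    then show ?thesis ..
  next
    case False
    then have "wt (x div 2) = 0" using "1.prems" by (simp add: wt_div2[of x] odd_iff_mod_2_eq_one)
    then have "x = 2 ^ 0" using False by (auto elim: oddE)
    then show ?thesis ..
  qed
qed

lemma wt_eq_sum_bits: "x < 2 ^ N \<Longrightarrow> wt x = (\<Sum>p<N. x div 2 ^ p mod 2)"
proof (induction N arbitrary: x)
  case (Suc N)
  have "wt x = x mod 2 + (\<Sum>p<N. x div 2 div 2 ^ p mod 2)"
    using Suc by (subst wt_div2) (simp add: less_mult_imp_div_less)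
  also have "\<dots> = (\<Sum>p<Suc N. x div 2 ^ p mod 2)"
    by (subst sum.lessThan_Suc_shift) (simp add: div_mult2_eq)
  finally show ?case .
qed simp

section \<open>The excitation-reading channel\<close>

text \<open>Chain states are plain functions on \<open>nat\<close>; their values from index
  \<open>D\<close> on are junk. Two states are thus usually known to agree only below
  \<open>D\<close>, and become equal as functions after one more \<open>app\<close>.\<close>

definition app :: "nat \<Rightarrow> (nat \<Rightarrow> nat \<Rightarrow> complex) \<Rightarrow> (nat \<Rightarrow> complex) \<Rightarrow> nat \<Rightarrow> complex" where
  "app D u v = (\<lambda>x. \<Sum>y<D. u x y * v y)"

text \<open>Qubit 1 is the most significant bit, so \<open>x mod 2^NB\<close> is the content of
  \<open>B\<close>. With another second argument \<open>j\<close> the predicate speaks of the last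
  \<open>j\<close> qubits of the chain.\<close>

definition vanishes_on_B :: "nat \<Rightarrow> nat \<Rightarrow> (nat \<Rightarrow> complex) \<Rightarrow> bool" where
  "vanishes_on_B N NB v \<longleftrightarrow> (\<forall>x<2^N. x mod 2^NB \<noteq> 0 \<longrightarrow> v x = 0)"

definition exc :: "nat \<Rightarrow> (nat \<Rightarrow> complex) \<Rightarrow> real" where
  "exc D v = (\<Sum>x<D. wt x * (cmod (v x))\<^sup>2)"

lemma app_cong: "(\<And>y. y < D \<Longrightarrow> v y = w y) \<Longrightarrow> app D u v = app D u w"
  by (simp add: app_def)

lemma app_scale: "app D u (\<lambda>y. c * v y) = (\<lambda>x. c * app D u v x)"
  by (simp add: app_def sum_distrib_left mult_ac)

lemma exc_nonneg: "0 \<le> exc D v"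
  by (simp add: exc_def sum_nonneg)

text \<open>\<open>kraus N NB u b\<close> is \<open>(1 \<otimes> |0><b|) u\<close>: the chain evolves, \<open>b\<close> is read off from \<open>B\<close> into a
  fresh memory register and \<open>B\<close> is reset. \<open>kstr\<close> composes these steps, with the record \<open>p\<close>
  read as a number in base \<open>2^NB\<close> whose last digit is the most recent one.\<close>

definition kraus :: "nat \<Rightarrow> nat \<Rightarrow> (nat \<Rightarrow> nat \<Rightarrow> complex) \<Rightarrow> nat \<Rightarrow> (nat \<Rightarrow> complex) \<Rightarrow> nat \<Rightarrow> complex" where
  "kraus N NB u b v = (\<lambda>x. if x mod 2^NB = 0 then app (2^N) u v (x + b) else 0)"

primrec kstr :: "nat \<Rightarrow> nat \<Rightarrow> (nat \<Rightarrow> nat \<Rightarrow> complex) \<Rightarrow> (nat \<Rightarrow> complex) \<Rightarrow> nat \<Rightarrow> nat \<Rightarrow> nat \<Rightarrow> complex" where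
  "kstr N NB u v 0 = (\<lambda>p. v)"
| "kstr N NB u v (Suc l) = (\<lambda>p. kraus N NB u (p mod 2^NB) (kstr N NB u v l (p div 2^NB)))"

text \<open>The expected number of excitations left in the chain after \<open>k\<close> further
  rounds, summed over all records. The recursion peels off the earliest round, as the contraction
  argument needs, whereas \<open>kstr\<close> appends the latest one.\<close>

primrec resid :: "nat \<Rightarrow> nat \<Rightarrow> (nat \<Rightarrow> nat \<Rightarrow> complex) \<Rightarrow> nat \<Rightarrow> (nat \<Rightarrow> complex) \<Rightarrow> real" where
  "resid N NB u 0 = exc (2^N)"
| "resid N NB u (Suc k) = (\<lambda>v. \<Sum>b<2^NB. resid N NB u k (kraus N NB u b v))"

lemma vanishes_on_B_cong:
  "(\<And>x. x < 2^N \<Longrightarrow> v x = w x) \<Longrightarrow> vanishes_on_B N NB v \<longleftrightarrow> vanishes_on_B N NB w"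
  by (auto simp: vanishes_on_B_def)

lemma vanishes_on_B_kraus: "vanishes_on_B N NB (kraus N NB u b v)"
  by (simp add: vanishes_on_B_def kraus_def)

text \<open>Each induction step moves one round from the record \<open>kstr\<close> to
  \<open>resid\<close>, so \<open>l\<close> has to stay free. The case \<open>l = 0\<close>
  identifies the two descriptions.\<close>

lemma sum_resid_kstr:
  "(\<Sum>p<2^(NB*(l+k)). exc (2^N) (kstr N NB u v (l+k) p)) = (\<Sum>p<2^(NB*l). resid N NB u k (kstr N NB u v l p))"
proof (induction k arbitrary: l)
  case (Suc k)
  have "(\<Sum>p<2^(NB*(l+Suc k)). exc (2^N) (kstr N NB u v (l+Suc k) p))
      = (\<Sum>p<2^(NB*Suc l). resid N NB u k (kstr N NB u v (Suc l) p))"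
    using Suc[of "Suc l"] by (simp only: add_Suc_shift)
  also have "\<dots> = (\<Sum>p<2^(NB*l)*2^NB. resid N NB u k (kstr N NB u v (Suc l) p))"
    by (simp add: power_add mult.commute)
  finally show ?case by (simp add: sum_lessThan_mult)
qed simp

lemma sum_exc_kstr: "(\<Sum>p<2^(NB*L). exc (2^N) (kstr N NB u v L p)) = resid N NB u L v"
  using sum_resid_kstr[where l=0 and k=L] by simp

text \<open>A state with empty \<open>B\<close> together with a reading \<open>b\<close> is the same
  datum as an arbitrary basis state \<open>x + b\<close>. The summand keeps both indices because the
  excitation count is taken after the reset, while the amplitude is the one before it.\<close>

lemma sum_kraus:
  fixes h :: "nat \<Rightarrow> nat \<Rightarrow> 'a::comm_monoid_add"
  assumes "NB \<le> N"
  shows "(\<Sum>b<2^NB. \<Sum>x<2^N. if x mod 2^NB = 0 then h x (x + b) else 0)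
       = (\<Sum>y<2^N. h (y div 2^NB * 2^NB) y)"
proof -
  have N: "(2::nat)^N = 2^(N-NB) * 2^NB" using assms by (simp flip: power_add)
  have "(\<Sum>b<2^NB. \<Sum>x<2^N. if x mod 2^NB = 0 then h x (x + b) else 0)
      = (\<Sum>b<2^NB. \<Sum>a<2^(N-NB). h (a * 2^NB) (a * 2^NB + b))"
  proof (rule sum.cong[OF refl])
    fix b
    have "(\<Sum>x<2^N. if x mod 2^NB = 0 then h x (x + b) else 0)
        = (\<Sum>a<2^(N-NB). \<Sum>b'<(2::nat)^NB. if b' = 0 then h (a * 2^NB) (a * 2^NB + b) else 0)"
      unfolding N sum_lessThan_mult by (intro sum.cong refl) auto
    also have "\<dots> = (\<Sum>a<2^(N-NB). h (a * 2^NB) (a * 2^NB + b))"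
      by simp
    finally show "(\<Sum>x<2^N. if x mod 2^NB = 0 then h x (x + b) else 0) = \<dots>" .
  qed
  also have "\<dots> = (\<Sum>a<2^(N-NB). \<Sum>b<2^NB. h (a * 2^NB) (a * 2^NB + b))"
    by (rule sum.swap)
  also have "\<dots> = (\<Sum>y<2^N. h (y div 2^NB * 2^NB) y)"
    unfolding N sum_lessThan_mult by (intro sum.cong refl) auto
  finally show ?thesis .
qed

lemma tendsto_app:
  assumes "\<And>y. y < D \<Longrightarrow> ((\<lambda>j. u j x y) \<longlongrightarrow> u' x y) F" "\<And>y. y < D \<Longrightarrow> ((\<lambda>j. v j y) \<longlongrightarrow> v' y) F"
  shows "((\<lambda>j. app D (u j) (v j) x) \<longlongrightarrow> app D u' v' x) F"
  unfolding app_def using assms by (intro tendsto_intros) auto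

lemma tendsto_exc:
  assumes "\<And>y. y < D \<Longrightarrow> ((\<lambda>j. v j y) \<longlongrightarrow> v' y) F"
  shows "((\<lambda>j. exc D (v j)) \<longlongrightarrow> exc D v') F"
  unfolding exc_def using assms by (intro tendsto_intros) auto

section \<open>Continuity and homogeneity of the residual excitation number\<close>

lemma tendsto_resid:
  assumes "\<And>y. y < 2^N \<Longrightarrow> ((\<lambda>j. v j y) \<longlongrightarrow> v' y) F"
  shows "((\<lambda>j. resid N NB u k (v j)) \<longlongrightarrow> resid N NB u k v') F"
  using assms
proof (induction k arbitrary: v v')
  case 0
  then show ?case by (simp add: tendsto_exc)
next
  case (Suc k)
  have "((\<lambda>j. kraus N NB u b (v j) y) \<longlongrightarrow> kraus N NB u b v' y) F" for b y
    unfolding kraus_def using Suc.prems by (auto intro: tendsto_app)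
  then show ?case by (auto intro!: tendsto_sum Suc.IH)
qed

lemma resid_scale: "resid N NB u k (\<lambda>y. c * v y) = (cmod c)\<^sup>2 * resid N NB u k v"
proof (induction k arbitrary: v)
  case 0
  show ?case by (simp add: exc_def norm_mult power_mult_distrib sum_distrib_left mult_ac)
next
  case (Suc k)
  have "kraus N NB u b (\<lambda>y. c * v y) = (\<lambda>y. c * kraus N NB u b v y)" for b
    by (auto simp: kraus_def app_scale)
  then show ?case by (simp add: Suc sum_distrib_left)
qed

text \<open>All that the channel argument uses of the evolution: it is block diagonal with respect
  to the excitation number, and its columns are orthonormal.\<close>

locale leaky_chain =
  fixes N NB :: nat and u :: "nat \<Rightarrow> nat \<Rightarrow> complex"
  assumes NB_le: "NB \<le> N"
    and wt_conserved: "\<And>x y. x < 2^N \<Longrightarrow> y < 2^N \<Longrightarrow> wt x \<noteq> wt y \<Longrightarrow> u x y = 0"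
    and unitary: "\<And>y z. y < 2^N \<Longrightarrow> z < 2^N \<Longrightarrow> (\<Sum>x<2^N. cnj (u x y) * u x z) = of_bool (y = z)"
begin

text \<open>A block diagonal unitary commutes with every function \<open>g\<close> of the number
  operator. Constant \<open>g\<close> gives preservation of inner products, and the identity gives
  conservation of excitations.\<close>

lemma sum_weighted_app:
  fixes g :: "nat \<Rightarrow> complex"
  shows "(\<Sum>x<2^N. g (wt x) * (cnj (app (2^N) u v x) * app (2^N) u w x)) = (\<Sum>x<2^N. g (wt x) * (cnj (v x) * w x))"
proof -
  have "(\<Sum>x<2^N. g (wt x) * (cnj (app (2^N) u v x) * app (2^N) u w x))
      = (\<Sum>x<2^N. \<Sum>y<2^N. \<Sum>z<2^N. g (wt x) * (cnj (u x y) * u x z) * (cnj (v y) * w z))"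
    by (simp add: app_def sum_product sum_distrib_left mult_ac)
  \<comment> \<open>\<open>u x y\<close> vanishes unless the weights agree, so the weight may be
    read off at \<open>y\<close>, which frees the sum over \<open>x\<close> for unitarity.\<close>
  also have "\<dots> = (\<Sum>x<2^N. \<Sum>y<2^N. \<Sum>z<2^N. g (wt y) * (cnj (u x y) * u x z) * (cnj (v y) * w z))"
    using wt_conserved by (intro sum.cong refl) (metis complex_cnj_zero lessThan_iff mult_zero_left mult_zero_right)
  also have "\<dots> = (\<Sum>y<2^N. \<Sum>z<2^N. \<Sum>x<2^N. g (wt y) * (cnj (u x y) * u x z) * (cnj (v y) * w z))"
    by (rule trans[OF sum.swap], rule sum.cong[OF refl], rule sum.swap)
  also have "\<dots> = (\<Sum>y<2^N. \<Sum>z<2^N. g (wt y) * (\<Sum>x<2^N. cnj (u x y) * u x z) * (cnj (v y) * w z))"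
    by (simp add: sum_distrib_left sum_distrib_right)
  also have "\<dots> = (\<Sum>y<2^N. \<Sum>z<2^N. if z = y then g (wt y) * (cnj (v y) * w y) else 0)"
    by (intro sum.cong refl) (auto simp: unitary)
  also have "\<dots> = (\<Sum>y<2^N. g (wt y) * (cnj (v y) * w y))"
    by simp
  finally show ?thesis .
qed

lemma exc_app: "exc (2^N) (app (2^N) u v) = exc (2^N) v"
proof -
  have "complex_of_real (exc (2^N) (app (2^N) u v)) = complex_of_real (exc (2^N) v)"
    using sum_weighted_app[of of_nat v v]
    by (simp add: exc_def complex_norm_square mult.commute del: of_real_power flip: of_real_power)
  then show ?thesis by (simp only: of_real_eq_iff)
qed

text \<open>Completeness of the Kraus operators: sending a chain state to its amplitudes over record
  and chain is an isometry. Inner products rather than norms are tracked, since a Gram matrix is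
  wanted in the end.\<close>

lemma sum_inner_kstr:
  "(\<Sum>p<2^(NB*l). \<Sum>x<2^N. cnj (kstr N NB u v l p x) * kstr N NB u w l p x) = (\<Sum>x<2^N. cnj (v x) * w x)"
proof (induction l)
  case (Suc l)
  have 1: "(\<Sum>b<2^NB. \<Sum>x<2^N. cnj (kraus N NB u b v x) * kraus N NB u b w x) = (\<Sum>x<2^N. cnj (v x) * w x)" for v w
  proof -
    have "(\<Sum>b<2^NB. \<Sum>x<2^N. cnj (kraus N NB u b v x) * kraus N NB u b w x)
      = (\<Sum>b<2^NB. \<Sum>x<2^N. if x mod 2^NB = 0 then cnj (app (2^N) u v (x+b)) * app (2^N) u w (x+b) else 0)"
      by (intro sum.cong refl) (auto simp: kraus_def)
    also have "\<dots> = (\<Sum>x<2^N. cnj (app (2^N) u v x) * app (2^N) u w x)"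
      using NB_le by (rule sum_kraus)
    finally show ?thesis using sum_weighted_app[of "\<lambda>_. 1" v w] by simp
  qed
  have "(\<Sum>p<2^(NB*Suc l). \<Sum>x<2^N. cnj (kstr N NB u v (Suc l) p x) * kstr N NB u w (Suc l) p x)
    = (\<Sum>p<2^(NB*l) * 2^NB. \<Sum>x<2^N. cnj (kstr N NB u v (Suc l) p x) * kstr N NB u w (Suc l) p x)"
    by (simp add: power_add mult.commute)
  also have "\<dots> = (\<Sum>p<2^(NB*l). \<Sum>x<2^N. cnj (kstr N NB u v l p x) * kstr N NB u w l p x)"
    by (simp add: sum_lessThan_mult 1)
  finally show ?case using Suc by simp
qed simp

text \<open>The balance of one round. The weight of a basis state splits into the part outside
  \<open>B\<close>, which stays, and the part inside \<open>B\<close>, which is carried off into the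
  memory.\<close>

lemma sum_exc_kraus:
  "(\<Sum>b<2^NB. exc (2^N) (kraus N NB u b v)) + (\<Sum>x<2^N. wt (x mod 2^NB) * (cmod (app (2^N) u v x))\<^sup>2) = exc (2^N) v"
proof -
  have wt: "wt x = wt (x div 2^NB * 2^NB) + wt (x mod 2^NB)" for x
  proof -
    have "wt (x div 2^NB * 2^NB + x mod 2^NB) = wt (x div 2^NB) + wt (x mod 2^NB)"
      by (rule wt_mult_power2_add) simp
    then show ?thesis
      using wt_mult_power2_add[of 0 NB "x div 2^NB"] by (simp only: div_mult_mod_eq) simp
  qed
  have "(\<Sum>b<2^NB. exc (2^N) (kraus N NB u b v))
      = (\<Sum>b<2^NB. \<Sum>x<2^N. if x mod 2^NB = 0 then wt x * (cmod (app (2^N) u v (x + b)))\<^sup>2 else 0)"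
    unfolding exc_def by (intro sum.cong refl) (auto simp: kraus_def)
  also have "\<dots> = (\<Sum>y<2^N. wt (y div 2^NB * 2^NB) * (cmod (app (2^N) u v y))\<^sup>2)"
    using NB_le by (rule sum_kraus)
  finally have "(\<Sum>b<2^NB. exc (2^N) (kraus N NB u b v)) + (\<Sum>x<2^N. wt (x mod 2^NB) * (cmod (app (2^N) u v x))\<^sup>2)
      = (\<Sum>y<2^N. (wt (y div 2^NB * 2^NB) + wt (y mod 2^NB)) * (cmod (app (2^N) u v y))\<^sup>2)"
    by (simp add: sum.distrib distrib_right)
  also have "\<dots> = exc (2^N) (app (2^N) u v)"
    unfolding exc_def by (intro sum.cong refl) (subst (3) wt, simp)
  finally show ?thesis by (simp add: exc_app)
qed

lemma sum_exc_kraus_le: "(\<Sum>b<2^NB. exc (2^N) (kraus N NB u b v)) \<le> exc (2^N) v"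
proof -
  have "0 \<le> (\<Sum>x<2^N. wt (x mod 2^NB) * (cmod (app (2^N) u v x))\<^sup>2)"
    by (intro sum_nonneg) simp
  then show ?thesis using sum_exc_kraus[of v] by linarith
qed

lemma resid_le_exc: "resid N NB u k v \<le> exc (2^N) v"
proof (induction k arbitrary: v)
  case (Suc k)
  have "resid N NB u (Suc k) v \<le> (\<Sum>b<2^NB. exc (2^N) (kraus N NB u b v))"
    by (simp add: sum_mono Suc)
  then show ?case using sum_exc_kraus_le[of v] by linarith
qed simp

text \<open>Without any loss nothing may leave in the first round, so \<open>U v\<close> is empty on
  \<open>B\<close>. Then the reading 0 is the only one that occurs, the reset changes nothing, and
  the argument repeats with \<open>U v\<close> in place of \<open>v\<close>.\<close>

lemma resid_eq_exc_imp:
  assumes "vanishes_on_B N NB v" "resid N NB u k v = exc (2^N) v" "m \<le> k"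
  shows "vanishes_on_B N NB ((app (2^N) u ^^ m) v)"
  using assms
proof (induction k arbitrary: v m)
  case 0
  then show ?case by simp
next
  case (Suc k)
  let ?U = "app (2^N) u"
  have le: "resid N NB u (Suc k) v \<le> (\<Sum>b<2^NB. exc (2^N) (kraus N NB u b v))"
    by (simp add: sum_mono resid_le_exc)
  have nonneg: "0 \<le> (\<Sum>x<2^N. wt (x mod 2^NB) * (cmod (?U v x))\<^sup>2)"
    by (intro sum_nonneg) simp
  have eq: "(\<Sum>b<2^NB. resid N NB u k (kraus N NB u b v)) = (\<Sum>b<2^NB. exc (2^N) (kraus N NB u b v))"
    and 0: "(\<Sum>x<2^N. wt (x mod 2^NB) * (cmod (?U v x))\<^sup>2) = 0"
    using le nonneg sum_exc_kraus[of v] Suc.prems(2) by auto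
  have Uv: "vanishes_on_B N NB (?U v)"
    unfolding vanishes_on_B_def
  proof (intro allI impI)
    fix x :: nat
    assume x: "x < 2^N" "x mod 2^NB \<noteq> 0"
    have "\<forall>x\<in>{..<2^N}. real (wt (x mod 2^NB)) * (cmod (?U v x))\<^sup>2 = 0"
      using 0 by (subst (asm) sum_nonneg_eq_0_iff) auto
    with x(1) have "real (wt (x mod 2^NB)) * (cmod (?U v x))\<^sup>2 = 0" by blast
    with x(2) show "?U v x = 0" by simp
  qed
  have k0: "kraus N NB u 0 v x = ?U v x" if "x < 2^N" for x
    using Uv that by (auto simp: kraus_def vanishes_on_B_def)
  \<comment> \<open>Equal sums of termwise ordered families are equal term by term; only the term
    for reading 0 is used below.\<close>
  have "(\<Sum>b<2^NB. exc (2^N) (kraus N NB u b v) - resid N NB u k (kraus N NB u b v)) = 0"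
    using eq by (simp add: sum_subtractf)
  then have "resid N NB u k (kraus N NB u 0 v) = exc (2^N) (kraus N NB u 0 v)"
    by (subst (asm) sum_nonneg_eq_0_iff) (auto simp: resid_le_exc)
  then have IH: "vanishes_on_B N NB ((?U ^^ m) (kraus N NB u 0 v))" if "m \<le> k" for m
    using Suc.IH that vanishes_on_B_kraus by blast
  show ?case
  proof (cases m)
    case 0
    then show ?thesis using Suc.prems by simp
  next
    case (Suc m')
    show ?thesis
    proof (cases m')
      case 0
      then show ?thesis using Uv Suc by simp
    next
      case (Suc m'')
      \<comment> \<open>\<open>k0\<close> holds only below \<open>2^N\<close>; one more application
        of \<open>U\<close> makes the functions equal, which is why \<open>m' = 0\<close> is treated
        apart.\<close>
      have "?U (kraus N NB u 0 v) = ?U (?U v)" using k0 by (intro app_cong) 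
      then have "(?U ^^ m') (kraus N NB u 0 v) = (?U ^^ m) v"
        by (simp add: Suc \<open>m = Suc m'\<close> funpow_Suc_right del: funpow.simps)
      then show ?thesis using IH[of m'] \<open>m = Suc m'\<close> Suc.prems by simp
    qed
  qed
qed

text \<open>The ground state carries weight 0, and conservation keeps its amplitude from feeding any
  other state, so the entry at 0 is never counted, in any later round.\<close>

lemma resid_cong_nonzero:
  assumes "\<And>x. x < 2^N \<Longrightarrow> x \<noteq> 0 \<Longrightarrow> v x = w x"
  shows "resid N NB u k v = resid N NB u k w"
  using assms
proof (induction k arbitrary: v w)
  case 0
  have "exc (2^N) v = exc (2^N) w"
    unfolding exc_def by (intro sum.cong refl) (metis "0" lessThan_iff mult_zero_left of_nat_0 wt_0)
  then show ?case by simp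
next
  case (Suc k)
  have eq: "app (2^N) u v y = app (2^N) u w y" if "y < 2^N" "y \<noteq> 0" for y
    unfolding app_def
  proof (intro sum.cong refl)
    fix z :: nat assume "z \<in> {..<2^N}"
    then show "u y z * v z = u y z * w z"
      using Suc.prems wt_conserved[of y 0] that by (cases "z = 0") auto
  qed
  have "kraus N NB u b v x = kraus N NB u b w x" if "x < 2^N" "x \<noteq> 0" "b < 2^NB" for b x
  proof (cases "x mod 2^NB = 0")
    case True
    then obtain a where a: "x = a * 2^NB" by (metis div_mult_mod_eq add_0_right)
    have N: "(2::nat)^N = 2^(N-NB) * 2^NB" using NB_le by (simp flip: power_add)
    have "x + b < 2^N" using that a mult_add_less_mult[of a "2^(N-NB)" b "2^NB"] N by simp
    then show ?thesis using eq that by (simp add: kraus_def)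
  qed (simp add: kraus_def)
  then show ?case by (auto intro!: sum.cong Suc.IH)
qed

text \<open>If no factor below 1 worked, there would be states of excitation number 1 with residual
  tending to 1. A limit of them loses nothing in \<open>K\<close> rounds, hence stays off
  \<open>B\<close> throughout, and \<open>drain\<close> makes it zero.\<close>

lemma resid_contraction:
  assumes drain: "\<And>v. v 0 = 0 \<Longrightarrow> (\<And>m. m \<le> K \<Longrightarrow> vanishes_on_B N NB ((app (2^N) u ^^ m) v)) \<Longrightarrow> (\<forall>x<2^N. v x = 0)"
  shows "\<exists>c. 0 \<le> c \<and> c < 1 \<and> (\<forall>v. vanishes_on_B N NB v \<longrightarrow> resid N NB u K v \<le> c * exc (2^N) v)"
proof (rule ccontr)
  assume contr: "\<not> ?thesis"
  define c :: "nat \<Rightarrow> real" where "c j = 1 - inverse (real (Suc j))" for j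
  have c: "0 \<le> c j" "c j < 1" for j by (auto simp: c_def field_simps)
  have clim: "c \<longlonglongrightarrow> 1"
    unfolding c_def using tendsto_diff[OF tendsto_const[of 1] LIMSEQ_inverse_real_of_nat] by simp
  have "\<exists>v. v 0 = 0 \<and> vanishes_on_B N NB v \<and> exc (2^N) v = 1 \<and> resid N NB u K v > c j" for j
  proof -
    obtain v where v: "vanishes_on_B N NB v" "resid N NB u K v > c j * exc (2^N) v"
      using contr c by (meson not_le)
    let ?e = "exc (2^N) v"
    have e: "?e > 0" using v(2) resid_le_exc[of K v] exc_nonneg[of "2^N" v] by (cases "?e = 0") auto
    \<comment> \<open>\<open>exc\<close> does not see the entry at 0, which could therefore be
      unbounded along the sequence. Erasing it changes no residual and makes the normalised states
      bounded.\<close>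
    define w where "w = v(0 := 0)"
    have w: "resid N NB u k w = resid N NB u k v" for k
      by (rule resid_cong_nonzero) (simp add: w_def)
    define z where "z = (\<lambda>y. complex_of_real (1 / sqrt ?e) * w y)"
    have z: "resid N NB u k z = (1 / ?e) * resid N NB u k v" for k
      using e by (simp only: z_def resid_scale norm_of_real) (simp add: power_divide w)
    have "z 0 = 0" "vanishes_on_B N NB z"
      using v(1) by (auto simp: z_def w_def vanishes_on_B_def)
    moreover have "exc (2^N) z = 1" using z[of 0] e by simp
    moreover have "resid N NB u K z > c j" using v(2) e by (simp add: z pos_less_divide_eq)
    ultimately show ?thesis by blast
  qed
  then obtain v where v: "\<And>j. v j 0 = 0" "\<And>j. vanishes_on_B N NB (v j)" "\<And>j. exc (2^N) (v j) = 1"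
      "\<And>j. resid N NB u K (v j) > c j"
    by metis
  have bd: "cmod (v j x) \<le> 1" if "x < 2^N" for j x
  proof (cases "x = 0")
    case False
    have "wt x * (cmod (v j x))\<^sup>2 \<le> exc (2^N) (v j)"
      unfolding exc_def by (rule member_le_sum) (use that in auto)
    moreover have "1 * (cmod (v j x))\<^sup>2 \<le> wt x * (cmod (v j x))\<^sup>2"
      using False wt_eq_0_iff[of x] by (intro mult_right_mono) (auto simp del: wt_eq_0_iff)
    ultimately show ?thesis using v(3)[of j] power2_le_imp_le[of "cmod (v j x)" 1] by simp
  qed (simp add: v(1))
  obtain r l where r: "strict_mono (r::nat\<Rightarrow>nat)" and l: "\<And>x. x < 2^N \<Longrightarrow> (\<lambda>j. v (r j) x) \<longlonglongrightarrow> l x"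
    using convergent_subsequence_pointwise[of "2^N" v] bd by (fastforce simp: bounded_iff)
  have "(\<lambda>j. exc (2^N) (v (r j))) \<longlonglongrightarrow> exc (2^N) l" using l by (rule tendsto_exc)
  then have exc: "exc (2^N) l = 1" using v(3) by (simp add: LIMSEQ_const_iff)
  have "(\<lambda>j. resid N NB u K (v (r j))) \<longlonglongrightarrow> resid N NB u K l" using l by (rule tendsto_resid)
  moreover have "(\<lambda>j. c (r j)) \<longlonglongrightarrow> 1"
    using LIMSEQ_subseq_LIMSEQ[OF clim r] by (simp add: o_def)
  ultimately have "1 \<le> resid N NB u K l"
    using v(4) by (intro LIMSEQ_le) (auto intro: less_imp_le)
  then have "resid N NB u K l = exc (2^N) l" using resid_le_exc[of K l] exc by linarith
  moreover have "l x = 0" if "x = 0 \<or> x mod 2^NB \<noteq> 0" "x < 2^N" for x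
  proof -
    have "v (r j) x = 0" for j using that v(1,2) by (auto simp: vanishes_on_B_def)
    then show ?thesis using l[OF that(2)] by (simp add: LIMSEQ_const_iff)
  qed
  ultimately have "\<forall>x<2^N. l x = 0"
    by (intro drain resid_eq_exc_imp) (auto simp: vanishes_on_B_def)
  then have "exc (2^N) l = 0" by (simp add: exc_def)
  with exc show False by simp
qed

text \<open>Every branch leaves a round with \<open>B\<close> empty, so the contraction applies anew
  to each branch after any number of rounds.\<close>

lemma resid_geometric:
  assumes c: "0 \<le> c" "\<And>v. vanishes_on_B N NB v \<Longrightarrow> resid N NB u K v \<le> c * exc (2^N) v"
    and v: "vanishes_on_B N NB v"
  shows "resid N NB u (j * K) v \<le> c ^ j * exc (2^N) v"
proof -
  have step: "resid N NB u (k + K) v \<le> c * resid N NB u k v" if "vanishes_on_B N NB v" for k v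
    using that
  proof (induction k arbitrary: v)
    case (Suc k)
    then show ?case by (simp add: sum_distrib_left sum_mono vanishes_on_B_kraus)
  qed (simp add: c)
  show ?thesis
  proof (induction j)
    case (Suc j)
    have "resid N NB u (Suc j * K) v \<le> c * resid N NB u (j * K) v"
      using step[OF v, of "j * K"] by (simp add: add.commute)
    also have "\<dots> \<le> c * (c ^ j * exc (2^N) v)" using Suc c(1) by (rule mult_left_mono)
    finally show ?case by (simp add: mult_ac)
  qed simp
qed

lemma resid_small:
  assumes drain: "\<And>v. v 0 = 0 \<Longrightarrow> (\<And>m. m \<le> K \<Longrightarrow> vanishes_on_B N NB ((app (2^N) u ^^ m) v)) \<Longrightarrow> (\<forall>x<2^N. v x = 0)"
    and "0 < \<delta>"
  shows "\<exists>L\<ge>1. \<forall>v. vanishes_on_B N NB v \<longrightarrow> exc (2^N) v \<le> C \<longrightarrow> resid N NB u L v \<le> \<delta>"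
proof -
  obtain c where c: "0 \<le> c" "c < 1" "\<And>v. vanishes_on_B N NB v \<Longrightarrow> resid N NB u K v \<le> c * exc (2^N) v"
    using resid_contraction[OF drain] by blast
  have "(\<lambda>j. c ^ j * C) \<longlonglongrightarrow> 0 * C"
    using c by (intro tendsto_intros) auto
  then have "eventually (\<lambda>j. c ^ j * C < \<delta>) sequentially"
    using \<open>0 < \<delta>\<close> by (intro order_tendstoD(2)) auto
  then obtain j where j: "c ^ j * C < \<delta>"
    using eventually_happens by force
  \<comment> \<open>The extra round guarantees a positive number of rounds and costs nothing, as
    excitations never increase.\<close>
  have "resid N NB u (Suc (j * K)) v \<le> \<delta>" if v: "vanishes_on_B N NB v" "exc (2^N) v \<le> C" for v
  proof -
    have "resid N NB u (Suc (j * K)) v \<le> (\<Sum>b<2^NB. c ^ j * exc (2^N) (kraus N NB u b v))"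
      using resid_geometric[OF c(1,3) vanishes_on_B_kraus] by (simp add: sum_mono)
    also have "\<dots> \<le> c ^ j * exc (2^N) v"
      using sum_exc_kraus_le[of v] c(1) by (simp add: mult_left_mono flip: sum_distrib_left)
    also have "\<dots> \<le> c ^ j * C" using v c(1) by (simp add: mult_left_mono)
    finally show ?thesis using j by linarith
  qed
  then show ?thesis by (intro exI[of _ "Suc (j * K)"]) auto
qed

end

section \<open>The time evolution\<close>

lemma mat_mult_entry:
  assumes "A \<in> carrier_mat n m" "B \<in> carrier_mat m k" "i < n" "j < k"
  shows "(A * B) $$ (i, j) = (\<Sum>z<m. A $$ (i, z) * B $$ (z, j))"
  using assms by (simp add: scalar_prod_def atLeast0LessThan)

lemma pow_mat_Suc_left:
  assumes "A \<in> carrier_mat n n"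
  shows "A ^\<^sub>m Suc k = A * A ^\<^sub>m k"
proof (induction k)
  case 0
  show ?case using assms by simp
next
  case (Suc k)
  have "A ^\<^sub>m Suc (Suc k) = (A * A ^\<^sub>m k) * A" using Suc by simp
  also have "\<dots> = A * A ^\<^sub>m Suc k" using assms by (simp add: assoc_mult_mat[of _ n n _ n _ n])
  finally show ?case .
qed

lemma pow_mat_smult:
  fixes A :: "'a::comm_ring_1 mat"
  assumes "A \<in> carrier_mat n n"
  shows "(c \<cdot>\<^sub>m A) ^\<^sub>m k = c ^ k \<cdot>\<^sub>m (A ^\<^sub>m k)"
proof (induction k)
  case 0
  show ?case using assms by (intro eq_matI) auto
next
  case (Suc k)
  have A: "A ^\<^sub>m k \<in> carrier_mat n n" using assms by simp
  have "(c \<cdot>\<^sub>m A) ^\<^sub>m Suc k = (c ^ k \<cdot>\<^sub>m (A ^\<^sub>m k)) * (c \<cdot>\<^sub>m A)" using Suc by simp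
  also have "\<dots> = c ^ Suc k \<cdot>\<^sub>m (A ^\<^sub>m k * A)"
    using A assms by (intro eq_matI) (auto simp: mult_smult_assoc_mat[of _ n n] mult_smult_distrib[of _ n n])
  finally show ?case by simp
qed

definition exp_coeff :: "complex mat \<Rightarrow> nat \<Rightarrow> nat \<Rightarrow> nat \<Rightarrow> complex" where
  "exp_coeff H x y n = (- \<i>) ^ n * (H ^\<^sub>m n) $$ (x, y) / fact n"

text \<open>The entry of \<open>exp(-iHs)\<close> as a power series in a complex \<open>s\<close>,
  so that termwise differentiation applies on the whole plane; the evolution is its restriction to
  real \<open>s\<close>.\<close>

definition exp_entry :: "complex mat \<Rightarrow> nat \<Rightarrow> nat \<Rightarrow> complex \<Rightarrow> complex" where
  "exp_entry H x y s = (\<Sum>n. exp_coeff H x y n * s ^ n)"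

lemma evol_carrier: "H \<in> carrier_mat D D \<Longrightarrow> evol H t \<in> carrier_mat D D"
  by (simp add: evol_def mexp_def)

lemma evol_entry:
  assumes "H \<in> carrier_mat D D" "x < D" "y < D"
  shows "evol H t $$ (x, y) = exp_entry H x y (of_real t)"
proof -
  have "H ^\<^sub>m n \<in> carrier_mat D D" for n using assms by simp
  moreover have "(- \<i> * complex_of_real t) ^ n = (- \<i>) ^ n * of_real t ^ n" for n
    by (rule power_mult_distrib)
  ultimately have "(((- \<i> * complex_of_real t) \<cdot>\<^sub>m H) ^\<^sub>m n) $$ (x, y) / fact n = exp_coeff H x y n * of_real t ^ n" for n
    using assms by (simp add: pow_mat_smult[of _ D] exp_coeff_def del: mult_minus_left)
  then show ?thesis
    using assms by (simp add: evol_def mexp_def exp_entry_def)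
qed

lemma exp_coeff_0:
  assumes "H \<in> carrier_mat D D" "x < D" "y < D"
  shows "exp_coeff H x y 0 = of_bool (x = y)"
  using assms by (simp add: exp_coeff_def)

lemma exp_coeff_Suc_left:
  assumes "H \<in> carrier_mat D D" "x < D" "y < D"
  shows "of_nat (Suc n) * exp_coeff H x y (Suc n) = (\<Sum>z<D. - \<i> * H $$ (x, z) * exp_coeff H z y n)"
proof -
  have "(H ^\<^sub>m Suc n) $$ (x, y) = (\<Sum>z<D. H $$ (x, z) * (H ^\<^sub>m n) $$ (z, y))"
    using assms by (simp only: pow_mat_Suc_left[OF assms(1)]) (rule mat_mult_entry, auto)
  then show ?thesis
    by (simp add: exp_coeff_def sum_distrib_left field_simps del: pow_mat.simps of_nat_Suc)
qed

lemma exp_coeff_Suc_right: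
  assumes "H \<in> carrier_mat D D" "x < D" "y < D"
  shows "of_nat (Suc n) * exp_coeff H x y (Suc n) = (\<Sum>z<D. - \<i> * exp_coeff H x z n * H $$ (z, y))"
proof -
  have "(H ^\<^sub>m Suc n) $$ (x, y) = (\<Sum>z<D. (H ^\<^sub>m n) $$ (x, z) * H $$ (z, y))"
    using assms by (simp only: pow_mat.simps) (rule mat_mult_entry, auto)
  then show ?thesis
    by (simp add: exp_coeff_def sum_distrib_left field_simps del: pow_mat.simps of_nat_Suc)
qed

text \<open>With \<open>h\<close> the sum of all entry moduli, the entries of the
  \<open>n\<close>-th power are at most \<open>(D * h)^n\<close>, and the series is dominated by an
  exponential series.\<close>

lemma summable_exp_coeff:
  assumes H: "H \<in> carrier_mat D D" and xy: "x < D" "y < D"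
  shows "summable (\<lambda>n. exp_coeff H x y n * s ^ n)"
proof -
  define h where "h = (\<Sum>x<D. \<Sum>y<D. cmod (H $$ (x, y)))"
  have h: "cmod (H $$ (x, y)) \<le> h" if "x < D" "y < D" for x y
  proof -
    have "cmod (H $$ (x, y)) \<le> (\<Sum>y<D. cmod (H $$ (x, y)))"
      by (rule member_le_sum) (use that in auto)
    also have "\<dots> \<le> h" unfolding h_def
      by (rule member_le_sum[where f="\<lambda>x. \<Sum>y<D. cmod (H $$ (x, y))"]) (use that in \<open>auto intro: sum_nonneg\<close>)
    finally show ?thesis .
  qed
  have bound: "cmod ((H ^\<^sub>m n) $$ (x, y)) \<le> (D * h) ^ n" if "x < D" "y < D" for n x y
    using that
  proof (induction n arbitrary: y)
    case (Suc n)
    have h0: "0 \<le> h" using h[OF Suc.prems] norm_ge_zero order_trans by blast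
    have "cmod ((H ^\<^sub>m Suc n) $$ (x, y)) = cmod (\<Sum>z<D. (H ^\<^sub>m n) $$ (x, z) * H $$ (z, y))"
      using H Suc.prems by (simp only: pow_mat.simps) (subst mat_mult_entry[of _ D D _ D], auto)
    also have "\<dots> \<le> (\<Sum>z<D. (D * h) ^ n * h)"
      using Suc h h0 by (intro sum_norm_le) (auto simp: norm_mult intro!: mult_mono)
    also have "\<dots> = (D * h) ^ Suc n" by simp
    finally show ?case .
  qed (use H in auto)
  have "summable (\<lambda>n. inverse (fact n) * (D * h * cmod s) ^ n)"
    by (rule summable_exp)
  moreover have "norm (exp_coeff H x y n * s ^ n) \<le> inverse (fact n) * (D * h * cmod s) ^ n" for n
  proof -
    have "norm (exp_coeff H x y n * s ^ n) = cmod ((H ^\<^sub>m n) $$ (x, y)) * (cmod s ^ n / fact n)"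
      by (simp add: exp_coeff_def norm_mult norm_divide norm_power)
    also have "\<dots> \<le> (D * h) ^ n * (cmod s ^ n / fact n)"
      using bound[OF xy] by (intro mult_right_mono) auto
    finally show ?thesis by (simp add: power_mult_distrib divide_inverse mult_ac)
  qed
  ultimately show ?thesis by (rule summable_comparison_test')
qed

lemma exp_entry_0:
  assumes "H \<in> carrier_mat D D" "x < D" "y < D"
  shows "exp_entry H x y 0 = of_bool (x = y)"
  unfolding exp_entry_def using assms by (simp add: exp_coeff_0)

lemma suminf_sum_mult:
  fixes f :: "nat \<Rightarrow> nat \<Rightarrow> 'a::real_normed_algebra"
  assumes "\<And>z. z < D \<Longrightarrow> summable (f z)"
  shows "(\<Sum>n. \<Sum>z<D. c z * f z n) = (\<Sum>z<D. c z * suminf (f z))"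
  using assms by (subst suminf_sum) (auto intro!: summable_mult simp: suminf_mult)

lemma DERIV_exp_entry:
  assumes H: "H \<in> carrier_mat D D" and xy: "x < D" "y < D"
  shows "(exp_entry H x y has_field_derivative (\<Sum>n. diffs (exp_coeff H x y) n * s ^ n)) (at s)"
  unfolding exp_entry_def
  by (rule termdiffs_strong_converges_everywhere) (rule summable_exp_coeff[OF assms])

lemma DERIV_exp_entry_left:
  assumes H: "H \<in> carrier_mat D D" and xy: "x < D" "y < D"
  shows "(exp_entry H x y has_field_derivative (\<Sum>z<D. - \<i> * H $$ (x, z) * exp_entry H z y s)) (at s)"
proof -
  have "(\<Sum>n. diffs (exp_coeff H x y) n * s ^ n) = (\<Sum>n. \<Sum>z<D. - \<i> * H $$ (x, z) * (exp_coeff H z y n * s ^ n))"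
    unfolding diffs_def exp_coeff_Suc_left[OF assms] by (simp only: sum_distrib_right mult.assoc)
  also have "\<dots> = (\<Sum>z<D. - \<i> * H $$ (x, z) * exp_entry H z y s)"
    unfolding exp_entry_def using summable_exp_coeff[OF H] xy by (intro suminf_sum_mult)
  finally show ?thesis using DERIV_exp_entry[OF assms, of s] by simp
qed

lemma DERIV_exp_entry_right:
  assumes H: "H \<in> carrier_mat D D" and xy: "x < D" "y < D"
  shows "(exp_entry H x y has_field_derivative (\<Sum>z<D. - \<i> * exp_entry H x z s * H $$ (z, y))) (at s)"
proof -
  have "(\<Sum>n. diffs (exp_coeff H x y) n * s ^ n) = (\<Sum>n. \<Sum>z<D. - \<i> * H $$ (z, y) * (exp_coeff H x z n * s ^ n))"
    unfolding diffs_def exp_coeff_Suc_right[OF assms] by (simp only: sum_distrib_right sum_distrib_left mult_ac)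
  also have "\<dots> = (\<Sum>z<D. - \<i> * H $$ (z, y) * exp_entry H x z s)"
    unfolding exp_entry_def using summable_exp_coeff[OF H] xy by (intro suminf_sum_mult)
  finally show ?thesis using DERIV_exp_entry[OF assms, of s] by (simp add: mult_ac)
qed

text \<open>The product of the exponentials at \<open>-s\<close> and \<open>s\<close> has derivative
  0 and equals the identity at 0, which avoids multiplying two series. Placing \<open>H\<close> on
  the right when differentiating the first factor and on the left for the second makes the two
  contributions cancel without commuting anything.\<close>

lemma sum_exp_entry_inverse:
  assumes H: "H \<in> carrier_mat D D" and yz: "y < D" "z < D"
  shows "(\<Sum>x<D. exp_entry H y x (- s) * exp_entry H x z s) = of_bool (y = z)"
proof -
  let ?G = "\<lambda>s. \<Sum>x<D. exp_entry H y x (- s) * exp_entry H x z s"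
  have "(?G has_field_derivative 0) (at s)" for s
  proof -
    let ?A = "\<Sum>x<D. \<Sum>w<D. exp_entry H y w (-s) * H $$ (w, x) * exp_entry H x z s"
    have neg: "((\<lambda>s. exp_entry H y x (- s)) has_field_derivative
        (\<Sum>w<D. - \<i> * exp_entry H y w (-s) * H $$ (w, x)) * (- 1)) (at s)" if "x < D" for x
      by (rule DERIV_chain2[OF DERIV_exp_entry_right[OF H]]) (use yz that in \<open>auto intro!: derivative_eq_intros\<close>)
    have "(?G has_field_derivative (\<Sum>x<D. (\<Sum>w<D. - \<i> * exp_entry H y w (-s) * H $$ (w, x)) * (- 1) * exp_entry H x z s
        + (\<Sum>w<D. - \<i> * H $$ (x, w) * exp_entry H w z s) * exp_entry H y x (-s))) (at s)"
      using yz by (intro DERIV_sum DERIV_mult neg DERIV_exp_entry_left[OF H]) auto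
    also have "(\<Sum>x<D. (\<Sum>w<D. - \<i> * exp_entry H y w (-s) * H $$ (w, x)) * (- 1) * exp_entry H x z s
        + (\<Sum>w<D. - \<i> * H $$ (x, w) * exp_entry H w z s) * exp_entry H y x (-s))
       = \<i> * ?A - \<i> * (\<Sum>x<D. \<Sum>w<D. exp_entry H y x (-s) * H $$ (x, w) * exp_entry H w z s)"
      by (simp add: sum.distrib sum_distrib_left sum_distrib_right sum_negf sum_subtractf mult_ac)
    also have "(\<Sum>x<D. \<Sum>w<D. exp_entry H y x (-s) * H $$ (x, w) * exp_entry H w z s) = ?A"
      by (rule sum.swap)
    finally show ?thesis by simp
  qed
  then obtain c where "\<forall>s\<in>UNIV. ?G s = c"
    using has_field_derivative_zero_constant[of UNIV ?G] convex_UNIV by auto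
  then have "?G s = ?G 0" by (metis UNIV_I)
  also have "\<dots> = of_bool (y = z)"
    using yz by (simp add: exp_entry_0[OF H] of_bool_def if_distrib[where f="\<lambda>x. x * _"] cong: if_cong)
  finally show ?thesis .
qed

lemma hermitian_entry:
  assumes "hermitian_mat D H" "x < D" "y < D"
  shows "cnj (H $$ (x, y)) = H $$ (y, x)"
proof -
  have "adj H $$ (y, x) = cnj (H $$ (x, y))" using assms unfolding hermitian_mat_def adj_def by (subst index_transpose_mat) auto
  then show ?thesis using assms by (simp add: hermitian_mat_def)
qed

text \<open>Powers of a Hermitian matrix are Hermitian, and conjugating \<open>-i\<close> reverses
  the sign of the time.\<close>

lemma cnj_exp_entry:
  assumes H: "hermitian_mat D H" and xy: "x < D" "y < D"
  shows "cnj (exp_entry H x y (of_real t)) = exp_entry H y x (- of_real t)"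
proof -
  have Hc: "H \<in> carrier_mat D D" using H by (simp add: hermitian_mat_def)
  have pow: "cnj ((H ^\<^sub>m n) $$ (x, y)) = (H ^\<^sub>m n) $$ (y, x)" if "x < D" "y < D" for n x y
    using that
  proof (induction n arbitrary: x y)
    case (Suc n)
    have "cnj ((H ^\<^sub>m Suc n) $$ (x, y)) = (\<Sum>z<D. cnj ((H ^\<^sub>m n) $$ (x, z)) * cnj (H $$ (z, y)))"
      using Hc Suc.prems by (simp only: pow_mat.simps) (subst mat_mult_entry[of _ D D _ D], auto)
    also have "\<dots> = (\<Sum>z<D. H $$ (y, z) * (H ^\<^sub>m n) $$ (z, x))"
      using Suc hermitian_entry[OF H] by (intro sum.cong) auto
    also have "\<dots> = (H ^\<^sub>m Suc n) $$ (y, x)"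
      using Hc Suc.prems by (simp only: pow_mat_Suc_left[OF Hc]) (subst mat_mult_entry[of _ D D _ D], auto)
    finally show ?case .
  qed (use Hc in auto)
  have "cnj (exp_coeff H x y n * of_real t ^ n) = exp_coeff H y x n * (- of_real t) ^ n" for n
  proof -
    have "cnj (exp_coeff H x y n * of_real t ^ n) = (\<i> ^ n * of_real t ^ n) * ((H ^\<^sub>m n) $$ (y, x) / fact n)"
      by (simp add: exp_coeff_def pow[OF xy])
    also have "\<i> ^ n * of_real t ^ n = (- \<i>) ^ n * (- of_real t) ^ n"
      by (simp flip: power_mult_distrib)
    finally show ?thesis by (simp only: exp_coeff_def times_divide_eq_left times_divide_eq_right mult_ac)
  qed
  moreover have "(\<lambda>n. cnj (exp_coeff H x y n * of_real t ^ n)) sums cnj (exp_entry H x y (of_real t))"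
    unfolding sums_cnj exp_entry_def by (intro summable_sums summable_exp_coeff[OF Hc xy])
  ultimately show ?thesis by (simp add: exp_entry_def sums_iff)
qed

lemma evol_unitary:
  assumes H: "hermitian_mat D H" and yz: "y < D" "z < D"
  shows "(\<Sum>x<D. cnj (evol H t $$ (x, y)) * evol H t $$ (x, z)) = of_bool (y = z)"
proof -
  have Hc: "H \<in> carrier_mat D D" using H by (simp add: hermitian_mat_def)
  have "(\<Sum>x<D. cnj (evol H t $$ (x, y)) * evol H t $$ (x, z)) = (\<Sum>x<D. exp_entry H y x (- of_real t) * exp_entry H x z (of_real t))"
    using yz by (intro sum.cong refl) (simp add: evol_entry[OF Hc] cnj_exp_entry[OF H])
  then show ?thesis using sum_exp_entry_inverse[OF Hc yz] by simp
qed

lemma evol_block_diagonal: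
  assumes Hc: "H \<in> carrier_mat D D" and block: "\<And>x y. x < D \<Longrightarrow> y < D \<Longrightarrow> g x \<noteq> g y \<Longrightarrow> H $$ (x, y) = 0"
    and xy: "x < D" "y < D" "g x \<noteq> g y"
  shows "evol H t $$ (x, y) = 0"
proof -
  have "(H ^\<^sub>m n) $$ (x, y) = 0" if "y < D" "g x \<noteq> g y" for n y
    using that
  proof (induction n arbitrary: y)
    case 0
    then show ?case using xy Hc by auto
  next
    case (Suc n)
    have "(H ^\<^sub>m Suc n) $$ (x, y) = (\<Sum>z<D. (H ^\<^sub>m n) $$ (x, z) * H $$ (z, y))"
      using Hc Suc.prems xy by (simp only: pow_mat.simps) (rule mat_mult_entry, auto)
    also have "\<dots> = 0"
      using Suc block by (intro sum.neutral ballI) (metis lessThan_iff mult_zero_left mult_zero_right)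
    finally show ?case .
  qed
  then show ?thesis using xy by (simp add: evol_entry[OF Hc] exp_entry_def exp_coeff_def)
qed

lemma evol_difference_quotient:
  assumes Hc: "H \<in> carrier_mat D D" and xy: "x < D" "y < D" and h: "h \<longlonglongrightarrow> 0" "\<And>j. h j \<noteq> 0"
  shows "(\<lambda>j. (evol H (h j) $$ (x, y) - of_bool (x = y)) / of_real (h j)) \<longlonglongrightarrow> - \<i> * H $$ (x, y)"
proof -
  have "(exp_entry H x y has_field_derivative (\<Sum>z<D. - \<i> * H $$ (x, z) * exp_entry H z y 0)) (at 0)"
    by (rule DERIV_exp_entry_left[OF Hc xy])
  moreover have "(\<Sum>z<D. - \<i> * H $$ (x, z) * exp_entry H z y 0) = - \<i> * H $$ (x, y)"
    using xy by (simp add: exp_entry_0[OF Hc] of_bool_def if_distrib[where f="\<lambda>x. _ * x"] sum_negf cong: if_cong)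
  ultimately have "((\<lambda>s. (exp_entry H x y (0 + s) - exp_entry H x y 0) / s) \<longlongrightarrow> - \<i> * H $$ (x, y)) (at 0)"
    by (simp add: DERIV_def)
  moreover have "filterlim (\<lambda>j. complex_of_real (h j)) (at 0) sequentially"
    using h tendsto_of_real[OF h(1)] by (auto simp: filterlim_at)
  ultimately have "(\<lambda>j. (exp_entry H x y (0 + of_real (h j)) - exp_entry H x y 0) / of_real (h j)) \<longlonglongrightarrow> - \<i> * H $$ (x, y)"
    by (rule filterlim_compose)
  then show ?thesis using xy by (simp add: evol_entry[OF Hc] exp_entry_0[OF Hc])
qed

section \<open>Nearest-neighbour hopping\<close>

text \<open>An index splits into a prefix for the left identity, a digit in base \<open>k\<close>
  for \<open>a\<close>, and a suffix for the right identity; the identities demand equal prefixes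
  and suffixes.\<close>

lemma kron_id_id_entry:
  assumes a: "a \<in> carrier_mat k k" and ij: "i < m * k * n" "j < m * k * n"
  shows "kron (kron (1\<^sub>m m) a) (1\<^sub>m n) $$ (i, j) =
    (if i div (n * k) = j div (n * k) \<and> i mod n = j mod n then a $$ (i div n mod k, j div n mod k) else 0)"
proof -
  have n: "n > 0" and k: "k > 0" using ij by (auto intro: Nat.gr0I)
  have dn: "i div n < m * k" "j div n < m * k" using ij by (auto simp: less_mult_imp_div_less)
  then have dnk: "i div n div k < m" "j div n div k < m" by (auto simp: less_mult_imp_div_less)
  have "kron (1\<^sub>m m) a $$ (i div n, j div n)
    = (if i div n div k = j div n div k then a $$ (i div n mod k, j div n mod k) else 0)"
    using a dn dnk by (simp add: kron_def)
  then show ?thesis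
    using a ij n unfolding kron_def[of "kron (1\<^sub>m m) a"] by (simp add: kron_def div_mult2_eq)
qed

lemma embed1_entry:
  assumes a: "a \<in> carrier_mat 2 2" and n: "1 \<le> n" "n \<le> N" and p: "p = N - n" and ij: "i < 2^N" "j < 2^N"
  shows "embed1 N n a $$ (i, j) =
    (if i div 2^(p+1) = j div 2^(p+1) \<and> i mod 2^p = j mod 2^p then a $$ (i div 2^p mod 2, j div 2^p mod 2) else 0)"
proof -
  have "(2::nat)^(n-1) * 2 * 2^(N-n) = 2^(n-1 + 1 + (N-n))" by (simp only: power_add power_one_right)
  also have "n - 1 + 1 + (N - n) = N" using n by simp
  finally have N: "2^N = (2::nat)^(n-1) * 2 * 2^(N-n)" ..
  show ?thesis
    using kron_id_id_entry[OF a ij[unfolded N]] by (simp add: embed1_def p mult.commute)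
qed

text \<open>Qubits \<open>n\<close> and \<open>n + 1\<close> are bits \<open>p + 1\<close> and
  \<open>p\<close>, read together as one digit in base 4. So \<open>p\<close> is the lowest bit of
  the window on which the term acts.\<close>

lemma embed2_entry:
  assumes a: "a \<in> carrier_mat 4 4" and n: "1 \<le> n" "n < N" and p: "p = N - n - 1" and ij: "i < 2^N" "j < 2^N"
  shows "embed2 N n a $$ (i, j) =
    (if i div 2^(p+2) = j div 2^(p+2) \<and> i mod 2^p = j mod 2^p then a $$ (i div 2^p mod 4, j div 2^p mod 4) else 0)"
proof -
  have "(2::nat)^(n-1) * 4 * 2^(N-n-1) = 2^(n-1 + 2 + (N-n-1))" by (simp add: power_add)
  also have "n - 1 + 2 + (N - n - 1) = N" using n by simp
  finally have N: "2^N = (2::nat)^(n-1) * 4 * 2^(N-n-1)" ..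
  show ?thesis
    using kron_id_id_entry[OF a ij[unfolded N]] by (simp add: embed2_def p mult.commute)
qed

lemma eq_if_bits_agree:
  fixes i j p :: nat
  assumes "i div 2^(p+1) = j div 2^(p+1)" "i mod 2^p = j mod 2^p" "i div 2^p mod 2 = j div 2^p mod 2"
  shows "i = j"
proof -
  have "i div 2^p div 2 = j div 2^p div 2" using assms(1) by (simp add: mult.commute flip: div_mult2_eq)
  then have "i div 2^p = j div 2^p" using assms(3) by (metis div_mult_mod_eq)
  then show ?thesis using assms(2) by (metis div_mult_mod_eq)
qed

lemma Ztot_entry:
  assumes ij: "i < 2^N" "j < 2^N"
  shows "Ztot N $$ (i, j) = (if i = j then of_nat N - 2 * of_nat (wt i) else 0)"
proof -
  have e: "embed1 N n pauliZ $$ (i, j) = (if i = j then 1 - 2 * of_nat (i div 2^(N-n) mod 2) else 0)"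
    if "n \<in> {1..N}" for n
  proof -
    have Z: "pauliZ \<in> carrier_mat 2 2" by (simp add: pauliZ_def)
    have "embed1 N n pauliZ $$ (i, j) = (if i div 2^(N-n+1) = j div 2^(N-n+1) \<and> i mod 2^(N-n) = j mod 2^(N-n)
        then pauliZ $$ (i div 2^(N-n) mod 2, j div 2^(N-n) mod 2) else 0)"
      using that by (intro embed1_entry[OF Z _ _ _ ij]) auto
    also have "\<dots> = (if i = j then 1 - 2 * of_nat (i div 2^(N-n) mod 2) else 0)"
      using eq_if_bits_agree[of i "N-n" j] by (auto simp: pauliZ_def)
    finally show ?thesis .
  qed
  have "Ztot N $$ (i, j) = (\<Sum>n\<in>{1..N}. if i = j then 1 - 2 * of_nat (i div 2^(N-n) mod 2) else 0)"
    using ij e by (simp add: Ztot_def msum_def del: One_nat_def)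
  also have "\<dots> = (\<Sum>p<N. if i = j then 1 - 2 * of_nat (i div 2^p mod 2) else 0)"
    by (rule sum.reindex_bij_witness[of _ "\<lambda>p. N - p" "\<lambda>n. N - n"]) auto
  also have "\<dots> = (if i = j then of_nat N - 2 * of_nat (wt i) else 0)"
    by (cases "i = j") (use wt_eq_sum_bits[OF ij(1)] in \<open>simp_all add: sum_subtractf sum_distrib_left\<close>)
  finally show ?thesis .
qed

text \<open>\<open>Ztot\<close> is \<open>N\<close> minus twice the number operator, so entry
  \<open>(x, y)\<close> of the commutator is \<open>H $$ (x, y)\<close> times
  \<open>2 * (wt x - wt y)\<close>.\<close>

lemma wt_conserved_if_commutes:
  assumes H: "H \<in> carrier_mat (2^N) (2^N)" and comm: "H * Ztot N = Ztot N * H"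
    and xy: "x < 2^N" "y < 2^N" "wt x \<noteq> wt y"
  shows "H $$ (x, y) = 0"
proof -
  have Z: "Ztot N \<in> carrier_mat (2^N) (2^N)" by (simp add: Ztot_def msum_def)
  have "(H * Ztot N) $$ (x, y) = (\<Sum>z<2^N. H $$ (x, z) * Ztot N $$ (z, y))"
    by (rule mat_mult_entry[OF H Z xy(1,2)])
  also have "\<dots> = (\<Sum>z<2^N. if z = y then H $$ (x, y) * (of_nat N - 2 * of_nat (wt y)) else 0)"
    using xy by (intro sum.cong refl) (auto simp: Ztot_entry)
  finally have 1: "(H * Ztot N) $$ (x, y) = H $$ (x, y) * (of_nat N - 2 * of_nat (wt y))" using xy by simp
  have "(Ztot N * H) $$ (x, y) = (\<Sum>z<2^N. Ztot N $$ (x, z) * H $$ (z, y))"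
    by (rule mat_mult_entry[OF Z H xy(1,2)])
  also have "\<dots> = (\<Sum>z<2^N. if z = x then (of_nat N - 2 * of_nat (wt x)) * H $$ (x, y) else 0)"
    using xy by (intro sum.cong refl) (auto simp: Ztot_entry)
  finally have 2: "(Ztot N * H) $$ (x, y) = (of_nat N - 2 * of_nat (wt x)) * H $$ (x, y)" using xy by simp
  have "H $$ (x, y) * (2 * (of_nat (wt x) - of_nat (wt y)))
      = H $$ (x, y) * (of_nat N - 2 * of_nat (wt y)) - (of_nat N - 2 * of_nat (wt x)) * H $$ (x, y)"
    by (simp add: algebra_simps)
  also have "\<dots> = 0" unfolding 1[symmetric] 2[symmetric] comm by simp
  finally have "H $$ (x, y) * (2 * (of_nat (wt x) - of_nat (wt y))) = 0" .
  moreover have "(2 * (of_nat (wt x) - of_nat (wt y)) :: complex) \<noteq> 0" using xy by simp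
  ultimately show ?thesis by (metis mult_eq_0_iff)
qed

text \<open>\<open>a * 2^(i+2) + 2^i\<close> and \<open>a * 2^(i+2) + 2^(i+1)\<close> are the two basis states with prefix \<open>a\<close>
  and a single further excitation, on bit \<open>i\<close> and on bit \<open>i + 1\<close> respectively.\<close>

lemma hop_bits:
  fixes a i :: nat
  shows "(a * 2^(i+2) + 2^i) mod 2^(i+1) = 2^i"
    "(a * 2^(i+2) + 2^i) div 2^(i+1) = 2 * a" "(a * 2^(i+2) + 2^(i+1)) div 2^(i+1) = 2 * a + 1"
    "(a * 2^(i+2) + 2^i) div 2^i = 4 * a + 1" "(a * 2^(i+2) + 2^(i+1)) div 2^i = 4 * a + 2"
    "(a * 2^(i+2) + 2^i) div 2^(i+2) = a" "(a * 2^(i+2) + 2^(i+1)) div 2^(i+2) = a"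
    "(a * 2^(i+2) + 2^i) mod 2^i = 0" "(a * 2^(i+2) + 2^(i+1)) mod 2^i = 0"
    "(a * 2^(i+2) + 2^(i+1)) mod 2^(i+1) = 0"
proof -
  have y1: "a * 2^(i+2) + 2^i = 2^i + (2 * a) * 2^(i+1)" and x1: "a * 2^(i+2) + 2^(i+1) = 0 + (2 * a + 1) * 2^(i+1)"
    by (simp_all add: algebra_simps)
  have y2: "a * 2^(i+2) + 2^i = 0 + (4 * a + 1) * 2^i" and x2: "a * 2^(i+2) + 2^(i+1) = 0 + (4 * a + 2) * 2^i"
    by (simp_all add: algebra_simps)
  show "(a * 2^(i+2) + 2^i) mod 2^(i+1) = 2^i" unfolding y1 by (subst mod_mult_self1) simp
  show "(a * 2^(i+2) + 2^i) div 2^(i+1) = 2 * a" unfolding y1 by (subst div_mult_self1) auto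
  show "(a * 2^(i+2) + 2^(i+1)) div 2^(i+1) = 2 * a + 1" unfolding x1 by (subst div_mult_self1) auto
  show "(a * 2^(i+2) + 2^i) div 2^i = 4 * a + 1" unfolding y2 by (subst div_mult_self1) auto
  show "(a * 2^(i+2) + 2^(i+1)) div 2^i = 4 * a + 2" unfolding x2 by (subst div_mult_self1) auto
  show "(a * 2^(i+2) + 2^i) div 2^(i+2) = a" "(a * 2^(i+2) + 2^(i+1)) div 2^(i+2) = a"
    by (simp_all)
  show "(a * 2^(i+2) + 2^i) mod 2^i = 0" unfolding y2 by simp
  show "(a * 2^(i+2) + 2^(i+1)) mod 2^i = 0" unfolding x2 by simp
  show "(a * 2^(i+2) + 2^(i+1)) mod 2^(i+1) = 0" unfolding x1 by simp
qed

section \<open>Basis states that a local term can connect\<close>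

lemma div_power2_eq_mono:
  fixes y z p q :: nat
  assumes "y div 2^p = z div 2^p" "p \<le> q"
  shows "y div 2^q = z div 2^q"
proof -
  have "(2::nat)^q = 2^p * 2^(q-p)" using assms(2) by (simp flip: power_add)
  then show ?thesis using assms(1) by (simp add: div_mult2_eq)
qed

lemma window_below_hop:
  fixes y z p i :: nat
  assumes "y mod 2^p = z mod 2^p" "y mod 2^(i+1) \<noteq> z mod 2^(i+1)"
  shows "p \<le> i"
proof (rule ccontr)
  assume "\<not> p \<le> i"
  then have "(2::nat)^(i+1) dvd 2^p" by (intro le_imp_power_dvd) simp
  then have "y mod 2^(i+1) = z mod 2^(i+1)" using assms(1) by (metis mod_mod_cancel)
  with assms(2) show False by simp
qed

text \<open>\<open>y\<close> is excited on bit \<open>i\<close> while \<open>z\<close> is empty up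
  to that bit, so a term connecting them has its window start at \<open>i\<close> or below. With at
  most two bits it cannot reach beyond bit \<open>i + 1\<close>, and the prefix \<open>a\<close> is
  kept.\<close>

lemma hop_target:
  fixes y z p k a i :: nat
  assumes y: "y = a * 2^(i+2) + 2^i" and z: "z mod 2^(i+1) = 0"
    and agree: "y div 2^(p+k) = z div 2^(p+k)" "y mod 2^p = z mod 2^p" and k: "k \<le> 2"
  shows "z = a * 2^(i+2) \<or> z = a * 2^(i+2) + 2^(i+1)"
proof -
  have "y mod 2^(i+1) \<noteq> z mod 2^(i+1)" unfolding y z hop_bits by simp
  with agree(2) have "p \<le> i" by (rule window_below_hop)
  with k have "y div 2^(i+2) = z div 2^(i+2)" by (intro div_power2_eq_mono[OF agree(1)]) auto
  then have za: "z div 2^(i+2) = a" unfolding y hop_bits ..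
  have zi: "z = z div 2^(i+1) * 2^(i+1)" using z by (metis add.right_neutral div_mult_mod_eq)
  have "z div 2^(i+1) div 2 = a" using za by (simp add: mult.commute flip: div_mult2_eq)
  then have "z div 2^(i+1) = 2 * a \<or> z div 2^(i+1) = 2 * a + 1" by linarith
  then have "z = 2 * a * 2^(i+1) \<or> z = (2 * a + 1) * 2^(i+1)" using zi by metis
  then show ?thesis by (simp add: distrib_right mult_ac add_ac)
qed

text \<open>The two states differ on both bits \<open>i\<close> and \<open>i + 1\<close>, so a
  window of at most two bits must be exactly that pair.\<close>

lemma hop_window:
  fixes p k a i :: nat
  assumes agree: "(a * 2^(i+2) + 2^i) div 2^(p+k) = (a * 2^(i+2) + 2^(i+1)) div 2^(p+k)"
      "(a * 2^(i+2) + 2^i) mod 2^p = (a * 2^(i+2) + 2^(i+1)) mod 2^p" and k: "k \<le> 2"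
  shows "p = i \<and> k = 2"
proof -
  have p: "p \<le> i" by (rule window_below_hop[OF agree(2)]) (unfold hop_bits, simp)
  have "\<not> p + k \<le> i + 1"
    using div_power2_eq_mono[OF agree(1), of "i+1"] unfolding hop_bits by auto
  with p k show ?thesis by auto
qed

lemma nn_form_entry:
  assumes "nn_form N H"
  obtains a b where "\<And>n. a n \<in> carrier_mat 2 2" "\<And>n. b n \<in> carrier_mat 4 4"
    "\<And>x y. x < 2^N \<Longrightarrow> y < 2^N \<Longrightarrow> H $$ (x, y) =
      (\<Sum>n\<in>{1..N}. embed1 N n (a n) $$ (x, y)) + (\<Sum>n\<in>{1..<N}. embed2 N n (b n) $$ (x, y))"
proof -
  from assms obtain a b where ab: "\<forall>n. a n \<in> carrier_mat 2 2" "\<forall>n. b n \<in> carrier_mat 4 4"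
    and H: "H = msum (2^N) (\<lambda>n. embed1 N n (a n)) {1..N} + msum (2^N) (\<lambda>n. embed2 N n (b n)) {1..<N}"
    unfolding nn_form_def by blast
  show ?thesis
    by (rule that[of a b]) (use ab in \<open>auto simp: H msum_def\<close>)
qed

lemma nn_form_hop_target:
  assumes nn: "nn_form N H" and y: "y = a * 2^(i+2) + 2^i" and z: "z mod 2^(i+1) = 0"
    and lt: "y < 2^N" "z < 2^N" and nz: "H $$ (y, z) \<noteq> 0"
  shows "z = a * 2^(i+2) \<or> z = a * 2^(i+2) + 2^(i+1)"
proof (rule ccontr)
  assume contr: "\<not> ?thesis"
  then have no: "\<not> (y div 2^(p+k) = z div 2^(p+k) \<and> y mod 2^p = z mod 2^p)" if "k \<le> 2" for p k
    using hop_target[OF y z] that by blast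
  obtain a b where ab: "\<And>n. a n \<in> carrier_mat 2 2" "\<And>n. b n \<in> carrier_mat 4 4"
    and e: "\<And>x y. x < 2^N \<Longrightarrow> y < 2^N \<Longrightarrow> H $$ (x, y) =
      (\<Sum>n\<in>{1..N}. embed1 N n (a n) $$ (x, y)) + (\<Sum>n\<in>{1..<N}. embed2 N n (b n) $$ (x, y))"
    using nn_form_entry[OF nn] by blast
  have "embed1 N n (a n) $$ (y, z) = 0" if "n \<in> {1..N}" for n
    using that no[of 1 "N-n"] by (subst embed1_entry[OF ab(1) _ _ refl lt]) auto
  moreover have "embed2 N n (b n) $$ (y, z) = 0" if "n \<in> {1..<N}" for n
    using that no[of 2 "N-n-1"] by (subst embed2_entry[OF ab(2) _ _ refl lt]) auto
  ultimately have "H $$ (y, z) = 0" unfolding e[OF lt] by simp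
  with nz show False by simp
qed

text \<open>Only the coupling of the two qubits involved contributes, and it does not see the prefix
  \<open>a\<close>. Hence knowledge from the one-excitation sector extends to all sectors.\<close>

lemma nn_form_hop_amplitude:
  assumes nn: "nn_form N H" and lt: "a * 2^(i+2) + 2^(i+1) < 2^N"
  shows "H $$ (a * 2^(i+2) + 2^i, a * 2^(i+2) + 2^(i+1)) = H $$ (2^i, 2^(i+1))"
proof -
  obtain c b where cb: "\<And>n. c n \<in> carrier_mat 2 2" "\<And>n. b n \<in> carrier_mat 4 4"
    and e: "\<And>x y. x < 2^N \<Longrightarrow> y < 2^N \<Longrightarrow> H $$ (x, y) =
      (\<Sum>n\<in>{1..N}. embed1 N n (c n) $$ (x, y)) + (\<Sum>n\<in>{1..<N}. embed2 N n (b n) $$ (x, y))"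
    using nn_form_entry[OF nn] by blast
  \<comment> \<open>Bits \<open>i + 1\<close> and \<open>i\<close> are qubits
    \<open>N - 1 - i\<close> and \<open>N - i\<close>. In the base 4 digit, 1 is the excitation on
    the right qubit and 2 the one on the left.\<close>
  have amp: "H $$ (a * 2^(i+2) + 2^i, a * 2^(i+2) + 2^(i+1)) = b (N - 1 - i) $$ (1, 2)"
    if x: "a * 2^(i+2) + 2^(i+1) < 2^N" for a
  proof -
    let ?y = "a * 2^(i+2) + 2^i" and ?x = "a * 2^(i+2) + 2^(i+1)"
    have y: "?y < 2^N" using x by (rule le_less_trans[rotated]) simp
    have "(2::nat)^(i+1) < 2^N" using x by (rule le_less_trans[rotated]) simp
    then have i: "i + 1 < N" by (rule power_less_imp_less_exp[rotated]) simp
    have 1: "embed1 N n (c n) $$ (?y, ?x) = 0" if "n \<in> {1..N}" for n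
      using that hop_window[of a i "N-n" 1] by (subst embed1_entry[OF cb(1) _ _ refl y x]) auto
    have 2: "embed2 N n (b n) $$ (?y, ?x) = (if n = N - 1 - i then b n $$ (1, 2) else 0)" if n: "n \<in> {1..<N}" for n
    proof -
      have "embed2 N n (b n) $$ (?y, ?x) = (if ?y div 2^(N-n-1+2) = ?x div 2^(N-n-1+2) \<and> ?y mod 2^(N-n-1) = ?x mod 2^(N-n-1)
          then b n $$ (?y div 2^(N-n-1) mod 4, ?x div 2^(N-n-1) mod 4) else 0)"
        using n by (intro embed2_entry[OF cb(2) _ _ refl y x]) auto
      also have "\<dots> = (if n = N - 1 - i then b n $$ (1, 2) else 0)"
      proof (cases "n = N - 1 - i")
        case True
        then have p: "N - n - 1 = i" using i by simp
        show ?thesis unfolding p hop_bits using True by (simp add: mod_mult_self4 del: add_2_eq_Suc' add_Suc_right One_nat_def)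
      next
        case False
        then have "N - n - 1 \<noteq> i" using n by auto
        then show ?thesis using hop_window[of a i "N-n-1" 2] False by auto
      qed
      finally show ?thesis .
    qed
    have "H $$ (?y, ?x) = (\<Sum>n\<in>{1..<N}. if n = N - 1 - i then b n $$ (1, 2) else 0)"
      unfolding e[OF y x] using 1 2 by simp
    also have "\<dots> = b (N - 1 - i) $$ (1, 2)"
      using i by (subst sum.delta) auto
    finally show ?thesis .
  qed
  have "(2::nat)^(i+1) < 2^N" using lt by (rule le_less_trans[rotated]) simp
  then show ?thesis using amp[OF lt] amp[of 0] by simp
qed

text \<open>A vanishing amplitude cuts the one-excitation sector in two: no power of
  \<open>H\<close> then carries the excitation from the first qubit past the cut, and
  \<open>f1N\<close> is zero at all times.\<close>

lemma hop_amplitude_nonzero: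
  assumes H: "H \<in> carrier_mat (2^N) (2^N)" and nn: "nn_form N H"
    and cons: "\<And>x y. x < 2^N \<Longrightarrow> y < 2^N \<Longrightarrow> wt x \<noteq> wt y \<Longrightarrow> H $$ (x, y) = 0"
    and f: "f1N N H t0 \<noteq> 0" and i: "i + 1 < N"
  shows "H $$ (2^i, 2^(i+1)) \<noteq> 0"
proof
  assume zero: "H $$ (2^i, 2^(i+1)) = 0"
  have lt: "(2::nat)^k < 2^N" if "k < N" for k using that by simp
  \<comment> \<open>Bit 0 alone would not carry the induction on \<open>n\<close>; the whole far
    side of the cut does.\<close>
  have pow: "(H ^\<^sub>m n) $$ (2^k, 2^(N-1)) = 0" if "k \<le> i" for n k
    using that
  proof (induction n arbitrary: k)
    case 0
    then show ?case using H i lt[of k] lt[of "N-1"] by simp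
  next
    case (Suc n)
    have "(H ^\<^sub>m Suc n) $$ (2^k, 2^(N-1)) = (\<Sum>z<2^N. H $$ (2^k, z) * (H ^\<^sub>m n) $$ (z, 2^(N-1)))"
      unfolding pow_mat_Suc_left[OF H] using H i Suc.prems lt by (intro mat_mult_entry[of _ "2^N" "2^N" _ "2^N"]) auto
    also have "\<dots> = 0"
    proof (intro sum.neutral ballI)
      fix z :: nat assume z: "z \<in> {..<2^N}"
      show "H $$ (2^k, z) * (H ^\<^sub>m n) $$ (z, 2^(N-1)) = 0"
      proof (cases "H $$ (2^k, z) = 0")
        case False
        have k: "(2::nat)^k < 2^N" using Suc.prems i by simp
        then have "wt z = 1" using cons[of "2^k" z] False z by fastforce
        then obtain l where l: "z = 2^l" using wt_eq_1_imp_power2 by blast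
        show ?thesis
        proof (cases "l \<le> i")
          case True
          then show ?thesis using Suc.IH l by simp
        next
          case l_gt: False
          \<comment> \<open>An intermediate excitation on the near side is reached from bit
            \<open>k\<close> only by the hop to \<open>k + 1\<close>, which forces
            \<open>k = i\<close>, the severed link.\<close>
          then have "z mod 2^(k+1) = 0" using Suc.prems l
            by (simp only: mod_eq_0_iff_dvd) (intro le_imp_power_dvd, simp)
          then have "z = 0 \<or> z = 2^(k+1)"
            using nn_form_hop_target[OF nn, of "2^k" 0 k z] k z False by auto
          then have "l = k + 1" using l by (metis nat_power_eq_Suc_0_iff power_eq_0_iff power_inject_exp zero_neq_numeral one_less_numeral_iff semiring_norm(76))
          then have "k = i" using l_gt Suc.prems by simp
          then show ?thesis using zero l \<open>l = k + 1\<close> by simp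
        qed
      qed simp
    qed
    finally show ?case .
  qed
  have "f1N N H t0 = exp_entry H (2^0) (2^(N-1)) (of_real t0)"
    unfolding f1N_def using evol_entry[OF H, of "2^0" "2^(N-1)"] i lt[of 0] lt[of "N-1"] by simp
  also have "\<dots> = 0" using pow[of 0] by (simp add: exp_entry_def exp_coeff_def)
  finally show False using f by simp
qed

text \<open>If bit \<open>j\<close> is the lowest excited bit of \<open>x\<close>, let
  \<open>y\<close> be \<open>x\<close> with that excitation moved to bit \<open>j - 1\<close>. Once
  everything excited below bit \<open>j\<close> is known to vanish, \<open>x\<close> is the only
  state contributing to \<open>G w\<close> at \<open>y\<close>, and \<open>G w\<close> itself
  vanishes there; so the amplitude of \<open>w\<close> at \<open>x\<close> is zero. Each gained
  qubit uses up one power of \<open>G\<close>, hence the range \<open>k \<le> N - j\<close>; the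
  induction really starts at \<open>j = NB\<close>.\<close>

lemma hopping_drains:
  fixes G :: "nat \<Rightarrow> nat \<Rightarrow> complex"
  assumes NB: "1 \<le> NB" "NB \<le> N"
    and target: "\<And>a i z. a * 2^(i+2) + 2^(i+1) < 2^N \<Longrightarrow> z < 2^N \<Longrightarrow> z mod 2^(i+1) = 0 \<Longrightarrow>
        z \<noteq> a * 2^(i+2) + 2^(i+1) \<Longrightarrow> G (a * 2^(i+2) + 2^i) z = 0"
    and amplitude: "\<And>a i. a * 2^(i+2) + 2^(i+1) < 2^N \<Longrightarrow> G (a * 2^(i+2) + 2^i) (a * 2^(i+2) + 2^(i+1)) \<noteq> 0"
    and v0: "v 0 = 0" and van: "\<And>k. k \<le> N \<Longrightarrow> vanishes_on_B N NB ((app (2^N) G ^^ k) v)"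
  shows "\<forall>x<2^N. v x = 0"
proof -
  have "\<forall>k\<le>N - j. vanishes_on_B N j ((app (2^N) G ^^ k) v)" if "NB \<le> j" "j \<le> N" for j
    using that
  proof (induction j)
    case 0
    then show ?case using NB by simp
  next
    case (Suc j)
    show ?case
    proof (cases "NB = Suc j", use van in simp, intro allI impI)
      assume "NB \<noteq> Suc j"
      then have IH: "vanishes_on_B N j ((app (2^N) G ^^ k) v)" if "k \<le> N - j" for k
        using Suc that by simp
      obtain i where i: "j = i + 1" using Suc.prems \<open>NB \<noteq> Suc j\<close> NB by (cases j) auto
      fix k assume k: "k \<le> N - Suc j"
      let ?w = "(app (2^N) G ^^ k) v"
      show "vanishes_on_B N (Suc j) ?w"
        unfolding vanishes_on_B_def
      proof (intro allI impI)
        fix x :: nat assume x: "x < 2^N" "x mod 2^Suc j \<noteq> 0"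
        show "?w x = 0"
        proof (cases "x mod 2^j = 0")
          case False
          then show ?thesis using IH[of k] k x(1) by (auto simp: vanishes_on_B_def)
        next
          case True
          then have "x = x div 2^j * 2^j" by (metis add.right_neutral div_mult_mod_eq)
          moreover have "odd (x div 2^j)"
          proof
            assume "even (x div 2^j)"
            then obtain c where "x div 2^j = 2 * c" ..
            then have "x = c * 2^Suc j" using \<open>x = x div 2^j * 2^j\<close> by simp
            then show False using x(2) by simp
          qed
          ultimately obtain a where "x = (2 * a + 1) * 2^j" by (metis oddE)
          then have xa: "x = a * 2^(i+2) + 2^(i+1)" by (simp add: i algebra_simps)
          let ?y = "a * 2^(i+2) + 2^i"
          have y: "?y < 2^N" using x(1) unfolding xa by (rule le_less_trans[rotated]) simp
          have "?y mod 2^j \<noteq> 0" unfolding i hop_bits by simp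
          moreover have "vanishes_on_B N j ((app (2^N) G ^^ Suc k) v)" using IH[of "Suc k"] k Suc.prems by simp
          ultimately have "0 = app (2^N) G ?w ?y" using y by (auto simp: vanishes_on_B_def)
          also have "\<dots> = (\<Sum>z<2^N. if z = x then G ?y x * ?w x else 0)"
            unfolding app_def[of _ _ ?w]
          proof (intro sum.cong refl)
            fix z :: nat assume z: "z \<in> {..<2^N}"
            show "G ?y z * ?w z = (if z = x then G ?y x * ?w x else 0)"
            proof (cases "z mod 2^j = 0")
              case True
              then show ?thesis using target[of a i z] x(1) z unfolding xa i by auto
            next
              case False
              then have "?w z = 0" using IH[of k] k z by (auto simp: vanishes_on_B_def)
              then show ?thesis by auto
            qed
          qed
          also have "\<dots> = G ?y x * ?w x" using x(1) by simp
          finally show ?thesis using amplitude[of a i] x(1) unfolding xa by simp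
        qed
      qed
    qed
  qed
  \<comment> \<open>At \<open>j = N\<close> only the power 0 remains, and \<open>B\<close> has grown
    to the whole chain.\<close>
  from this[of N] have "vanishes_on_B N N v" using NB by simp
  then show ?thesis using v0 by (metis vanishes_on_B_def mod_less)
qed

text \<open>One \<open>t\<close> has to serve all \<open>v\<close>. Otherwise each time
  \<open>1 / (j + 1)\<close> has a bad vector, and a limit of these is drained by \<open>-iH\<close>
  although it has norm 1.\<close>

lemma evol_drains:
  assumes NB: "1 \<le> NB" "NB \<le> N"
    and H: "H \<in> carrier_mat (2^N) (2^N)" and nn: "nn_form N H"
    and cons: "\<And>x y. x < 2^N \<Longrightarrow> y < 2^N \<Longrightarrow> wt x \<noteq> wt y \<Longrightarrow> H $$ (x, y) = 0"
    and f: "f1N N H t0 \<noteq> 0"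
  shows "\<exists>t>0. \<forall>v. v 0 = 0 \<longrightarrow> (\<forall>m\<le>N. vanishes_on_B N NB ((app (2^N) (\<lambda>x y. evol H t $$ (x, y)) ^^ m) v)) \<longrightarrow>
    (\<forall>x<2^N. v x = 0)"
proof (rule ccontr)
  assume contr: "\<not> ?thesis"
  define h :: "nat \<Rightarrow> real" where "h j = inverse (real (Suc j))" for j
  have h: "h \<longlonglongrightarrow> 0" "h j > 0" for j
    unfolding h_def using LIMSEQ_inverse_real_of_nat by auto
  define u where "u j = (\<lambda>x y. evol H (h j) $$ (x, y))" for j
  define d where "d j = (\<lambda>x y. (u j x y - of_bool (x = y)) / of_real (h j))" for j
  define G where "G = (\<lambda>x y. - \<i> * H $$ (x, y))"
  have "\<exists>v. v 0 = 0 \<and> (\<forall>m\<le>N. vanishes_on_B N NB ((app (2^N) (u j) ^^ m) v)) \<and> (\<Sum>x<2^N. cmod (v x)) = 1" for j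
  proof -
    obtain v x where v: "v 0 = 0" "\<And>m. m \<le> N \<Longrightarrow> vanishes_on_B N NB ((app (2^N) (u j) ^^ m) v)" "x < 2^N" "v x \<noteq> 0"
      using contr h(2)[of j] unfolding u_def by blast
    let ?s = "\<Sum>x<2^N. cmod (v x)"
    have s: "?s > 0" using v(3,4) by (intro sum_pos2[of _ x]) auto
    define w where "w = (\<lambda>x. complex_of_real (1 / ?s) * v x)"
    have "(app (2^N) (u j) ^^ m) w = (\<lambda>x. complex_of_real (1 / ?s) * (app (2^N) (u j) ^^ m) v x)" for m
      by (induction m) (simp_all only: w_def funpow.simps o_apply id_apply app_scale)
    then have "vanishes_on_B N NB ((app (2^N) (u j) ^^ m) w)" if "m \<le> N" for m
      using v(2)[OF that] by (auto simp: vanishes_on_B_def)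
    moreover have "(\<Sum>x<2^N. cmod (w x)) = 1"
      using s by (simp only: w_def norm_mult norm_of_real flip: sum_distrib_left) simp
    moreover have "w 0 = 0" using v(1) by (simp add: w_def)
    ultimately show ?thesis by blast
  qed
  then obtain v where v: "\<And>j. v j 0 = 0" "\<And>j m. m \<le> N \<Longrightarrow> vanishes_on_B N NB ((app (2^N) (u j) ^^ m) (v j))"
      "\<And>j. (\<Sum>x<2^N. cmod (v j x)) = 1"
    by metis
  have bd: "cmod (v j x) \<le> 1" if "x < 2^N" for j x
    unfolding v(3)[of j, symmetric] by (rule member_le_sum) (use that in auto)
  obtain r l where r: "strict_mono (r::nat\<Rightarrow>nat)" and l: "\<And>x. x < 2^N \<Longrightarrow> (\<lambda>j. v (r j) x) \<longlonglongrightarrow> l x"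
    using convergent_subsequence_pointwise[of "2^N" v] bd by (fastforce simp: bounded_iff)
  have "(\<lambda>j. \<Sum>x<2^N. cmod (v (r j) x)) \<longlonglongrightarrow> (\<Sum>x<2^N. cmod (l x))"
    using l by (intro tendsto_intros) auto
  then have l1: "(\<Sum>x<2^N. cmod (l x)) = 1" by (simp add: v(3) LIMSEQ_const_iff)
  have l0: "l 0 = 0" using l[of 0] by (simp add: v(1) LIMSEQ_const_iff)
  have app_d: "app (2^N) (d j) w x = (app (2^N) (u j) w x - w x) / of_real (h j)" if "x < 2^N" for j w x
    using that by (simp add: app_def d_def left_diff_distrib sum_subtractf of_bool_def
        if_distrib[where f="\<lambda>x. x * _"] flip: sum_divide_distrib cong: if_cong)
  \<comment> \<open>Vanishing on \<open>B\<close> is a linear condition, and the \<open>k\<close>-th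
    power of \<open>(U - 1) / h\<close> applied to \<open>w\<close> is a combination of the
    \<open>U^m w\<close> with \<open>m \<le> k\<close>.\<close>
  have d: "vanishes_on_B N NB ((app (2^N) (d j) ^^ k) w)"
    if "\<And>m. m \<le> k \<Longrightarrow> vanishes_on_B N NB ((app (2^N) (u j) ^^ m) w)" for j k w
    using that
  proof (induction k arbitrary: w)
    case 0
    then show ?case by force
  next
    case (Suc k)
    let ?U = "app (2^N) (u j)"
    let ?w = "\<lambda>x. (?U w x - w x) / of_real (h j)"
    have pow: "(?U ^^ m) ?w = (\<lambda>x. ((?U ^^ Suc m) w x - (?U ^^ m) w x) / of_real (h j))" for m
    proof (induction m)
      case (Suc m)
      have "(?U ^^ Suc m) ?w = ?U (\<lambda>x. ((?U ^^ Suc m) w x - (?U ^^ m) w x) / of_real (h j))"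
        by (simp only: funpow.simps o_apply Suc)
      also have "\<dots> = (\<lambda>x. (?U ((?U ^^ Suc m) w) x - ?U ((?U ^^ m) w) x) / of_real (h j))"
        unfolding app_def[of _ _ "\<lambda>x. ((?U ^^ Suc m) w x - (?U ^^ m) w x) / of_real (h j)"]
          app_def[of _ _ "(?U ^^ Suc m) w"] app_def[of _ _ "(?U ^^ m) w"]
        by (simp add: right_diff_distrib diff_divide_distrib sum_subtractf sum_divide_distrib)
      finally show ?case by simp
    qed simp
    have "vanishes_on_B N NB ((app (2^N) (d j) ^^ k) ?w)"
    proof (rule Suc.IH)
      fix m assume "m \<le> k"
      then show "vanishes_on_B N NB ((?U ^^ m) ?w)"
        using Suc.prems[of m] Suc.prems[of "Suc m"] unfolding pow vanishes_on_B_def by simp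
    qed
    moreover have "(app (2^N) (d j) ^^ k) ?w x = (app (2^N) (d j) ^^ Suc k) w x" if "x < 2^N" for x
    proof (cases k)
      case 0
      then show ?thesis using app_d[OF that] by simp
    next
      case (Suc k')
      have "app (2^N) (d j) ?w = app (2^N) (d j) (app (2^N) (d j) w)"
        using app_d by (intro app_cong) simp
      then show ?thesis by (simp only: Suc funpow_Suc_right o_apply)
    qed
    ultimately show ?case
      using vanishes_on_B_cong[of N "(app (2^N) (d j) ^^ k) ?w" "(app (2^N) (d j) ^^ Suc k) w" NB] by blast
  qed
  have hr: "(\<lambda>j. h (r j)) \<longlonglongrightarrow> 0" using LIMSEQ_subseq_LIMSEQ[OF h(1) r] by (simp add: o_def)
  have dG: "(\<lambda>j. d (r j) x y) \<longlonglongrightarrow> G x y" if "x < 2^N" "y < 2^N" for x y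
    unfolding d_def u_def G_def using h(2) by (intro evol_difference_quotient[OF H that hr]) (metis less_irrefl)
  have lim: "(\<lambda>j. (app (2^N) (d (r j)) ^^ k) (v (r j)) x) \<longlonglongrightarrow> (app (2^N) G ^^ k) l x" if "x < 2^N" for k x
    using that
  proof (induction k arbitrary: x)
    case (Suc k)
    then show ?case using dG by (auto intro!: tendsto_app)
  qed (use l in simp)
  have van: "vanishes_on_B N NB ((app (2^N) G ^^ k) l)" if "k \<le> N" for k
    unfolding vanishes_on_B_def
  proof (intro allI impI)
    fix x :: nat assume x: "x < 2^N" "x mod 2^NB \<noteq> 0"
    have "vanishes_on_B N NB ((app (2^N) (d (r j)) ^^ k) (v (r j)))" for j
      using that v(2) by (intro d) auto
    then have "(app (2^N) (d (r j)) ^^ k) (v (r j)) x = 0" for j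
      using x by (auto simp: vanishes_on_B_def)
    then show "(app (2^N) G ^^ k) l x = 0" using lim[OF x(1), of k] by (simp add: LIMSEQ_const_iff)
  qed
  have target: "G (a * 2^(i+2) + 2^i) z = 0"
    if "a * 2^(i+2) + 2^(i+1) < 2^N" "z < 2^N" "z mod 2^(i+1) = 0" "z \<noteq> a * 2^(i+2) + 2^(i+1)" for a i z
  proof (rule ccontr)
    assume nz: "G (a * 2^(i+2) + 2^i) z \<noteq> 0"
    have y: "a * 2^(i+2) + 2^i < 2^N" using that(1) by (rule le_less_trans[rotated]) simp
    \<comment> \<open>Locality leaves one other candidate, in which the excitation has disappeared;
      conservation excludes it.\<close>
    have "z = a * 2^(i+2)"
      using nn_form_hop_target[OF nn refl that(3) y that(2)] nz that(4) by (auto simp: G_def)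
    moreover have "wt (a * 2^(i+2) + 2^i) = wt a + 1"
      using wt_mult_power2_add[of "2^i" "i+2" a] by simp
    moreover have "wt (a * 2^(i+2)) = wt a"
      using wt_mult_power2_add[of 0 "i+2" a] by simp
    ultimately have "H $$ (a * 2^(i+2) + 2^i, z) = 0" using that y by (intro cons) auto
    with nz show False by (simp add: G_def)
  qed
  have amplitude: "G (a * 2^(i+2) + 2^i) (a * 2^(i+2) + 2^(i+1)) \<noteq> 0" if "a * 2^(i+2) + 2^(i+1) < 2^N" for a i
  proof -
    have "(2::nat)^(i+1) < 2^N" using that by (rule le_less_trans[rotated]) simp
    then have "i + 1 < N" by (rule power_less_imp_less_exp[rotated]) simp
    then show ?thesis
      using hop_amplitude_nonzero[OF H nn cons f] nn_form_hop_amplitude[OF nn that] by (simp add: G_def)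
  qed
  have "\<forall>x<2^N. l x = 0"
    by (rule hopping_drains[where G = G, OF NB target amplitude l0 van])
  then show False using l1 by simp
qed

section \<open>The swap protocol in the computational basis\<close>

lemma bit_concat:
  fixes x y n k :: nat
  assumes "y < 2^n"
  shows "(x * 2^n + y) div 2^k mod 2 = (if k < n then y div 2^k mod 2 else x div 2^(k-n) mod 2)"
proof (cases "k < n")
  case True
  then have "(2::nat)^n = 2^k * 2^(n-k)" by (simp flip: power_add)
  then have "x * 2^n + y = y + (x * 2^(n-k)) * 2^k" by simp
  then have "(x * 2^n + y) div 2^k = x * 2^(n-k) + y div 2^k" by (simp only: div_mult_self1) simp
  moreover have "even ((2::nat)^(n-k))" using True by simp
  ultimately show ?thesis using True by (auto elim!: evenE simp: mod_add_left_eq[symmetric])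
next
  case False
  then have "(2::nat)^k = 2^n * 2^(k-n)" by (simp flip: power_add)
  then show ?thesis using False assms by (simp add: div_mult2_eq)
qed

lemma sum_bits:
  fixes x T :: nat
  assumes "x < 2^T"
  shows "(\<Sum>q\<in>{1..T}. (x div 2^(T-q) mod 2) * 2^(T-q)) = x"
proof -
  have "(\<Sum>q\<in>{1..T}. (x div 2^(T-q) mod 2) * 2^(T-q)) = (\<Sum>p<T. (x div 2^p mod 2) * 2^p)"
    by (rule sum.reindex_bij_witness[of _ "\<lambda>p. T - p" "\<lambda>n. T - n"]) auto
  also have "\<dots> = x" using assms
  proof (induction T arbitrary: x)
    case (Suc T)
    have "(\<Sum>p<Suc T. (x div 2^p mod 2) * 2^p) = x mod 2 + 2 * (\<Sum>p<T. (x div 2 div 2^p mod 2) * 2^p)"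
      by (subst sum.lessThan_Suc_shift) (simp add: div_mult2_eq sum_distrib_left mult_ac)
    also have "\<dots> = x mod 2 + 2 * (x div 2)" using Suc by (simp add: less_mult_imp_div_less)
    finally show ?case by simp
  qed simp
  finally show ?thesis .
qed

definition swap_index :: "nat \<Rightarrow> nat \<Rightarrow> nat \<Rightarrow> nat \<Rightarrow> nat \<Rightarrow> nat" where
  "swap_index N NB L l j =
    (\<Sum>q\<in>{1..N + NB*L}. (j div 2^(N + NB*L - swap_sigma N NB l q) mod 2) * 2^(N + NB*L - q))"

text \<open>\<open>a\<close> is the chain outside \<open>B\<close>, \<open>b\<close> the content of
  \<open>B\<close>, \<open>p\<close> the first \<open>l\<close> registers, \<open>d\<close> register
  \<open>l + 1\<close>, and \<open>r\<close> the \<open>s\<close> memory qubits after it. The swap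
  exchanges \<open>b\<close> and \<open>d\<close>, which is verified bit by bit according to the
  block a bit lies in.\<close>

lemma swap_index_eq:
  assumes NB: "NB \<le> N" and l: "l < L" and s: "s = NB * (L - Suc l)"
    and lt: "a < 2^(N-NB)" "b < 2^NB" "p < 2^(NB*l)" "d < 2^NB" "r < 2^s"
  shows "swap_index N NB L (Suc l) ((a * 2^NB + b) * 2^(NB*L) + ((p * 2^NB + d) * 2^s + r))
    = (a * 2^NB + d) * 2^(NB*L) + ((p * 2^NB + b) * 2^s + r)"
proof -
  define m where "m = NB * l"
  have "NB * L = NB * (l + 1 + (L - Suc l))" using l by simp
  then have L: "NB * L = m + NB + s" by (simp only: distrib_left m_def s mult_1_right)
  have m: "Suc l * NB = m + NB" "l * NB = m" by (simp_all add: m_def mult.commute)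
  have mem: "(p * 2^NB + e) * 2^s + r < 2^(m + NB + s)" if "e < 2^NB" for e
  proof -
    have "p * 2^NB + e < 2^m * 2^NB" using lt that by (intro mult_add_less_mult) (auto simp: m_def)
    then have "(p * 2^NB + e) * 2^s + r < 2^m * 2^NB * 2^s" using lt(5) by (rule mult_add_less_mult)
    then show ?thesis by (simp add: power_add)
  qed
  define T where "T = N + (m + NB + s)"
  define i where "i = (a * 2^NB + d) * 2^(m + NB + s) + ((p * 2^NB + b) * 2^s + r)"
  define j where "j = (a * 2^NB + b) * 2^(m + NB + s) + ((p * 2^NB + d) * 2^s + r)"
  have "a * 2^NB + d < 2^(N-NB) * 2^NB" using lt by (intro mult_add_less_mult)
  then have "a * 2^NB + d < 2^N" using NB by (simp flip: power_add)
  then have "i < 2^N * 2^(m + NB + s)" unfolding i_def using mem[OF lt(2)] by (rule mult_add_less_mult)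
  then have iT: "i < 2^T" by (simp add: T_def power_add)
  have bits: "j div 2^(T - swap_sigma N NB (Suc l) q) mod 2 = i div 2^(T - q) mod 2" if q: "q \<in> {1..T}" for q
  proof -
    define k where "k = T - q"
    have k: "q = T - k" "k < T" using q by (auto simp: k_def)
    have ibits: "i div 2^k mod 2 = (if k < m + NB + s then if k < s then r div 2^k mod 2 else
        if k - s < NB then b div 2^(k-s) mod 2 else p div 2^(k-s-NB) mod 2 else
        if k - (m+NB+s) < NB then d div 2^(k-(m+NB+s)) mod 2 else a div 2^(k-(m+NB+s)-NB) mod 2)" for k
      unfolding i_def using mem lt by (simp only: bit_concat)
    have jbits: "j div 2^k mod 2 = (if k < m + NB + s then if k < s then r div 2^k mod 2 else
        if k - s < NB then d div 2^(k-s) mod 2 else p div 2^(k-s-NB) mod 2 else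
        if k - (m+NB+s) < NB then b div 2^(k-(m+NB+s)) mod 2 else a div 2^(k-(m+NB+s)-NB) mod 2)" for k
      unfolding j_def using mem lt by (simp only: bit_concat)
    have \<sigma>: "swap_sigma N NB (Suc l) q = (if N - NB < q \<and> q \<le> N then q + (m + NB)
        else if N + m < q \<and> q \<le> N + (m + NB) then q - (m + NB) else q)"
      by (simp add: swap_sigma_def m del: mult_Suc)
    consider "N - NB < q \<and> q \<le> N" | "N + m < q \<and> q \<le> N + (m + NB)"
      | "\<not> (N - NB < q \<and> q \<le> N)" "\<not> (N + m < q \<and> q \<le> N + (m + NB))" by blast
    then show ?thesis
    proof cases
      case 1
      then have e: "T - swap_sigma N NB (Suc l) q = k - (m + NB)" and kk: "m + NB + s \<le> k" "k - (m+NB+s) < NB"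
        using q NB by (auto simp: \<sigma> k_def T_def)
      have "k - (m + NB) < m + NB + s" "\<not> k - (m + NB) < s" "k - (m + NB) - s = k - (m + NB + s)"
        using kk by auto
      then show ?thesis unfolding e k_def[symmetric] using kk by (simp add: ibits jbits)
    next
      case 2
      then have e: "T - swap_sigma N NB (Suc l) q = k + (m + NB)" and kk: "s \<le> k" "k - s < NB"
        using q NB by (auto simp: \<sigma> k_def T_def)
      have "\<not> k + (m + NB) < m + NB + s" "k + (m + NB) - (m + NB + s) = k - s" "k < m + NB + s"
        using kk by auto
      then show ?thesis unfolding e k_def[symmetric] using kk by (simp add: ibits jbits)
    next
      case 3
      then have e: "T - swap_sigma N NB (Suc l) q = k" unfolding \<sigma> k_def by (simp only: if_False)
      have kk: "k < s \<or> (s \<le> k \<and> \<not> k - s < NB \<and> k < m + NB + s) \<or> (\<not> k < m + NB + s \<and> \<not> k - (m+NB+s) < NB)"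
        using 3 q NB by (auto simp: k_def T_def)
      then show ?thesis unfolding e k_def[symmetric] by (auto simp: ibits jbits)
    qed
  qed
  have "swap_index N NB L (Suc l) j = (\<Sum>q\<in>{1..T}. (i div 2^(T-q) mod 2) * 2^(T-q))"
    unfolding swap_index_def L T_def[symmetric] using bits by simp
  then show ?thesis using sum_bits[OF iT] by (simp add: i_def j_def L)
qed

lemma swap_index_decompose:
  fixes x :: nat
  assumes NB: "NB \<le> N" and l: "l < L" and s: "s = NB * (L - Suc l)" and x: "x < 2^(N + NB*L)"
  obtains a b p d r where "a < 2^(N-NB)" "b < 2^NB" "p < 2^(NB*l)" "d < 2^NB" "r < 2^s"
    "x = (a * 2^NB + b) * 2^(NB*L) + ((p * 2^NB + d) * 2^s + r)"
proof -
  define c m where "c = x div 2^(NB*L)" and "m = x mod 2^(NB*L)"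
  have "c < 2^N" using x by (simp add: c_def power_add less_mult_imp_div_less)
  also have "\<dots> = 2^(N-NB) * 2^NB" using NB by (simp flip: power_add)
  finally have c: "c < 2^(N-NB) * 2^NB" .
  have "NB * L = NB * (l + 1 + (L - Suc l))" using l by simp
  then have L: "NB * L = NB * l + NB + s" by (simp only: distrib_left s mult_1_right)
  have m: "m < 2^(NB*l) * 2^NB * 2^s" unfolding m_def L power_add by (rule mod_less_divisor) simp
  then have "m div 2^s < 2^(NB*l) * 2^NB" by (rule less_mult_imp_div_less)
  then have "m div 2^s div 2^NB < 2^(NB*l)" by (rule less_mult_imp_div_less)
  moreover have "c div 2^NB < 2^(N-NB)" using c by (rule less_mult_imp_div_less)
  moreover have "x = (c div 2^NB * 2^NB + c mod 2^NB) * 2^(NB*L)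
      + ((m div 2^s div 2^NB * 2^NB + m div 2^s mod 2^NB) * 2^s + m mod 2^s)"
    by (simp only: div_mult_mod_eq) (simp only: c_def m_def div_mult_mod_eq)
  ultimately show ?thesis
    by (intro that[of "c div 2^NB" "c mod 2^NB" "m div 2^s div 2^NB" "m div 2^s mod 2^NB" "m mod 2^s"]) simp_all
qed

text \<open>The matrix gives its row as a function of the column. The swap being an involution, this
  turns into the column as a function of the row, the form needed for multiplying from the
  left.\<close>

lemma Sop_entry:
  assumes NB: "NB \<le> N" and l: "l < L" and ij: "i < 2^(N + NB*L)" "j < 2^(N + NB*L)"
  shows "Sop N NB L (Suc l) $$ (i, j) = of_bool (j = swap_index N NB L (Suc l) i)"
proof -
  have inv: "swap_index N NB L (Suc l) (swap_index N NB L (Suc l) x) = x" if "x < 2^(N + NB*L)" for x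
    by (rule swap_index_decompose[OF NB l refl that]) (simp add: swap_index_eq[OF NB l refl])
  have "Sop N NB L (Suc l) $$ (i, j) = of_bool (i = swap_index N NB L (Suc l) j)"
    using ij by (simp add: Sop_def qubit_perm_mat_def swap_index_def)
  also have "i = swap_index N NB L (Suc l) j \<longleftrightarrow> j = swap_index N NB L (Suc l) i"
    using inv[OF ij(1)] inv[OF ij(2)] by auto
  finally show ?thesis .
qed

section \<open>The protocol unitary column by column\<close>

lemma Sop_carrier: "Sop N NB L l \<in> carrier_mat (2^(N + NB*L)) (2^(N + NB*L))"
  by (simp add: Sop_def qubit_perm_mat_def)

lemma Uop_carrier:
  assumes "H \<in> carrier_mat (2^N) (2^N)"
  shows "Uop N NB L H t \<in> carrier_mat (2^(N + NB*L)) (2^(N + NB*L))"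
  using evol_carrier[OF assms, of t] by (simp add: Uop_def kron_def power_add)

lemma Wseq_carrier:
  assumes "\<And>l. S l \<in> carrier_mat D D" "U \<in> carrier_mat D D"
  shows "Wseq D S U l \<in> carrier_mat D D"
proof (induction l)
  case (Suc l)
  then show ?case
    unfolding Wseq.simps by (intro mult_carrier_mat[of _ D D _ D] assms)
qed simp

lemma Uop_mult_entry:
  assumes H: "H \<in> carrier_mat (2^N) (2^N)" and W: "W \<in> carrier_mat (2^(N + NB*L)) D"
    and c: "c < 2^N" and m: "m < 2^(NB*L)" and j: "j < D"
  shows "(Uop N NB L H t * W) $$ (c * 2^(NB*L) + m, j) = (\<Sum>c'<2^N. evol H t $$ (c, c') * W $$ (c' * 2^(NB*L) + m, j))"
proof -
  let ?M = "2^(NB*L) :: nat"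
  have E: "evol H t \<in> carrier_mat (2^N) (2^N)" using H by (rule evol_carrier)
  have lt: "c * ?M + m < 2^(N + NB*L)" if "c < 2^N" "m < ?M" for c m
    using mult_add_less_mult[OF that] by (simp add: power_add)
  have "(Uop N NB L H t * W) $$ (c * ?M + m, j) = (\<Sum>z<2^(N+NB*L). Uop N NB L H t $$ (c * ?M + m, z) * W $$ (z, j))"
    by (rule mat_mult_entry[OF Uop_carrier[OF H] W lt[OF c m] j])
  also have "\<dots> = (\<Sum>c'<2^N. \<Sum>m'<?M. Uop N NB L H t $$ (c * ?M + m, c' * ?M + m') * W $$ (c' * ?M + m', j))"
    unfolding power_add sum_lessThan_mult ..
  also have "\<dots> = (\<Sum>c'<2^N. \<Sum>m'<?M. if m' = m then evol H t $$ (c, c') * W $$ (c' * ?M + m, j) else 0)"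
  proof (intro sum.cong refl)
    fix c' m' :: nat assume "c' \<in> {..<2^N}" "m' \<in> {..<?M}"
    then have *: "c' < 2^N" "m' < ?M" by auto
    have "Uop N NB L H t $$ (c * ?M + m, c' * ?M + m') = evol H t $$ (c, c') * of_bool (m = m')"
      using E lt[OF c m] lt[OF *] * m unfolding Uop_def kron_def by (simp add: power_add)
    then show "Uop N NB L H t $$ (c * ?M + m, c' * ?M + m') * W $$ (c' * ?M + m', j)
      = (if m' = m then evol H t $$ (c, c') * W $$ (c' * ?M + m, j) else 0)" by auto
  qed
  also have "\<dots> = (\<Sum>c'<2^N. evol H t $$ (c, c') * W $$ (c' * ?M + m, j))" using m by simp
  finally show ?thesis .
qed

text \<open>After \<open>l\<close> rounds the last \<open>L - l\<close> registers are still empty,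
  which is the condition on \<open>m mod 2^(NB*(L-l))\<close>; the quotient is the record so far.
  The column is the one of basis state \<open>c0\<close> with empty memory.\<close>

lemma Wseq_column:
  assumes NB: "NB \<le> N" and H: "H \<in> carrier_mat (2^N) (2^N)" and c0: "c0 < 2^N" and "l \<le> L"
    and "c < 2^N" "m < 2^(NB*L)"
  shows "Wseq (2^(N + NB*L)) (Sop N NB L) (Uop N NB L H t) l $$ (c * 2^(NB*L) + m, c0 * 2^(NB*L)) =
    (if m mod 2^(NB*(L-l)) = 0
     then kstr N NB (\<lambda>x y. evol H t $$ (x, y)) (\<lambda>x. of_bool (x = c0)) l (m div 2^(NB*(L-l))) c else 0)"
  using assms(4-)
proof (induction l arbitrary: c m)
  case 0
  let ?M = "2^(NB*L) :: nat"
  have "c * ?M + m < 2^(N + NB*L)" "c0 * ?M + 0 < 2^(N + NB*L)"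
    using mult_add_less_mult[OF 0(2,3)] mult_add_less_mult[OF c0, of 0 ?M] by (simp_all add: power_add)
  moreover have "c * ?M + m = c0 * ?M \<longleftrightarrow> c = c0 \<and> m = 0"
  proof
    assume "c * ?M + m = c0 * ?M"
    then have "(c * ?M + m) div ?M = c0 * ?M div ?M" "(c * ?M + m) mod ?M = c0 * ?M mod ?M" by simp_all
    then show "c = c0 \<and> m = 0" using 0(3) by simp
  qed simp
  ultimately show ?case using 0(3) by simp
next
  case (Suc l)
  let ?M = "2^(NB*L) :: nat" and ?D = "2^(N + NB*L) :: nat" and ?U = "Uop N NB L H t"
  let ?W = "Wseq ?D (Sop N NB L) ?U" and ?u = "\<lambda>x y. evol H t $$ (x, y)" and ?v = "\<lambda>x. of_bool (x = c0) :: complex"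
  define s where "s = NB * (L - Suc l)"
  have l: "l < L" using Suc.prems by simp
  have "L - l = Suc (L - Suc l)" using l by simp
  then have sl: "NB * (L - l) = NB + s" by (simp add: s_def)
  have WC: "?W l \<in> carrier_mat ?D ?D" by (rule Wseq_carrier[OF Sop_carrier Uop_carrier[OF H]])
  have UW: "?U * ?W l \<in> carrier_mat ?D ?D" using Uop_carrier[OF H] WC by (rule mult_carrier_mat)
  have x: "c * ?M + m < ?D" using mult_add_less_mult[OF Suc.prems(2,3)] by (simp add: power_add)
  have j0: "c0 * ?M < ?D" using mult_add_less_mult[OF c0, of 0 ?M] by (simp add: power_add)
  obtain a b p d r where lt: "a < 2^(N-NB)" "b < 2^NB" "p < 2^(NB*l)" "d < 2^NB" "r < 2^s"
    and xe: "c * ?M + m = (a * 2^NB + b) * ?M + ((p * 2^NB + d) * 2^s + r)"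
    using swap_index_decompose[OF NB l s_def x] .
  have "NB * L = NB * (l + 1 + (L - Suc l))" using l by simp
  then have L: "NB * L = NB * l + NB + s" by (simp only: distrib_left s_def mult_1_right)
  have mem: "(p * 2^NB + e) * 2^s + r < ?M" if "e < 2^NB" for e
  proof -
    have "p * 2^NB + e < 2^(NB*l) * 2^NB" using lt that by (intro mult_add_less_mult) auto
    then have "(p * 2^NB + e) * 2^s + r < 2^(NB*l) * 2^NB * 2^s" using lt(5) by (rule mult_add_less_mult)
    then show ?thesis by (simp add: L power_add)
  qed
  have chain: "a * 2^NB + e < 2^N" if "e < 2^NB" for e
    using mult_add_less_mult[OF lt(1) that] NB by (simp flip: power_add)
  have "(c * ?M + m) div ?M = c" "(c * ?M + m) mod ?M = m" using Suc.prems by simp_all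
  then have ce: "c = a * 2^NB + b" and me: "m = (p * 2^NB + d) * 2^s + r"
    unfolding xe using mem[OF lt(4)] by simp_all
  let ?c = "a * 2^NB + d" and ?m = "(p * 2^NB + b) * 2^s + r"
  have y: "?c * ?M + ?m < ?D" using mult_add_less_mult[OF chain[OF lt(4)] mem[OF lt(2)]] by (simp add: power_add)
  have sw: "swap_index N NB L (Suc l) (c * ?M + m) = ?c * ?M + ?m"
    unfolding xe by (rule swap_index_eq[OF NB l s_def lt])
  have "?W (Suc l) $$ (c * ?M + m, c0 * ?M) = (Sop N NB L (Suc l) * (?U * ?W l)) $$ (c * ?M + m, c0 * ?M)"
    by (simp only: Wseq.simps assoc_mult_mat[OF Sop_carrier Uop_carrier[OF H] WC])
  also have "\<dots> = (\<Sum>z<?D. Sop N NB L (Suc l) $$ (c * ?M + m, z) * (?U * ?W l) $$ (z, c0 * ?M))"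
    by (rule mat_mult_entry[OF Sop_carrier UW x j0])
  also have "\<dots> = (\<Sum>z<?D. if z = ?c * ?M + ?m then (?U * ?W l) $$ (?c * ?M + ?m, c0 * ?M) else 0)"
    using Sop_entry[OF NB l x] sw by (intro sum.cong refl) auto
  also have "\<dots> = (?U * ?W l) $$ (?c * ?M + ?m, c0 * ?M)" using y by simp
  also have "\<dots> = (\<Sum>c'<2^N. evol H t $$ (?c, c') * ?W l $$ (c' * ?M + ?m, c0 * ?M))"
    by (rule Uop_mult_entry[OF H WC chain[OF lt(4)] mem[OF lt(2)] j0])
  also have "\<dots> = (\<Sum>c'<2^N. evol H t $$ (?c, c') *
      (if ?m mod 2^(NB+s) = 0 then kstr N NB ?u ?v l (?m div 2^(NB+s)) c' else 0))"
    using Suc.IH[OF _ _ mem[OF lt(2)], unfolded sl] l by simp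
  also have "\<dots> = (if ?m mod 2^(NB+s) = 0 then app (2^N) ?u (kstr N NB ?u ?v l (?m div 2^(NB+s))) ?c else 0)"
    by (simp add: app_def)
  \<comment> \<open>Before the swap the fresh register holds \<open>b\<close>, which ends up in
    \<open>B\<close>. It must be 0, and this is the reset built into \<open>kraus\<close>;
    \<open>d\<close> is the new digit of the record.\<close>
  also have "\<dots> = (if b = 0 \<and> r = 0 then app (2^N) ?u (kstr N NB ?u ?v l p) ?c else 0)"
  proof -
    have bs: "b * 2^s + r < 2^(NB+s)" using mult_add_less_mult[OF lt(2,5)] by (simp add: power_add)
    have me': "?m = (b * 2^s + r) + p * 2^(NB+s)" by (simp add: power_add algebra_simps)
    have "?m mod 2^(NB+s) = b * 2^s + r" "?m div 2^(NB+s) = p"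
      unfolding me' using bs by (simp_all only: mod_mult_self1 div_mult_self1) simp_all
    then show ?thesis by (simp only: add_is_0 mult_eq_0_iff power_not_zero zero_neq_numeral) simp
  qed
  also have "\<dots> = (if m mod 2^s = 0 then kstr N NB ?u ?v (Suc l) (m div 2^s) c else 0)"
  proof -
    have "m mod 2^s = r" "m div 2^s = p * 2^NB + d" unfolding me using lt by simp_all
    moreover have "c mod 2^NB = b" unfolding ce using lt by simp
    ultimately show ?thesis using lt ce by (simp add: kraus_def)
  qed
  finally show ?case by (simp only: s_def)
qed

lemma Wop_column:
  assumes "NB \<le> N" "H \<in> carrier_mat (2^N) (2^N)" "c0 < 2^N" "c < 2^N" "m < 2^(NB*L)"
  shows "Wop N NB L H t $$ (c * 2^(NB*L) + m, c0 * 2^(NB*L)) =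
    kstr N NB (\<lambda>x y. evol H t $$ (x, y)) (\<lambda>x. of_bool (x = c0)) L m c"
  using Wseq_column[OF assms(1-3) order_refl assms(4,5)] by (simp add: Wop_def)

lemma Wop_carrier:
  "H \<in> carrier_mat (2^N) (2^N) \<Longrightarrow> Wop N NB L H t \<in> carrier_mat (2^(N + NB*L)) (2^(N + NB*L))"
  unfolding Wop_def by (rule Wseq_carrier[OF Sop_carrier Uop_carrier])

section \<open>Nearly orthonormal families and fidelity\<close>

definition cinner :: "nat \<Rightarrow> (nat \<Rightarrow> complex) \<Rightarrow> (nat \<Rightarrow> complex) \<Rightarrow> complex" where
  "cinner d f g = (\<Sum>m<d. cnj (f m) * g m)"

definition cnorm :: "nat \<Rightarrow> (nat \<Rightarrow> complex) \<Rightarrow> real" where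
  "cnorm d f = L2_set (\<lambda>m. cmod (f m)) {..<d}"

lemma cnorm_nonneg [simp]: "0 \<le> cnorm d f"
  by (simp add: cnorm_def)

lemma cinner_self: "cinner d f f = of_real ((cnorm d f)\<^sup>2)"
proof -
  have "(cnorm d f)\<^sup>2 = (\<Sum>m<d. (cmod (f m))\<^sup>2)"
    by (simp add: cnorm_def L2_set_def sum_nonneg)
  then show ?thesis by (simp add: cinner_def complex_norm_square mult.commute del: of_real_power)
qed

lemma cinner_bound: "cmod (cinner d f g) \<le> cnorm d f * cnorm d g"
proof -
  have "cmod (cinner d f g) \<le> (\<Sum>m<d. cmod (f m) * cmod (g m))"
    unfolding cinner_def by (rule order_trans[OF norm_sum]) (simp add: norm_mult)
  also have "\<dots> \<le> cnorm d f * cnorm d g"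
    using L2_set_mult_ineq[of "\<lambda>m. cmod (f m)" "\<lambda>m. cmod (g m)" "{..<d}"] by (simp add: cnorm_def)
  finally show ?thesis .
qed

lemma cnorm_triangle: "cnorm d (\<lambda>m. f m + g m) \<le> cnorm d f + cnorm d g"
proof -
  have "cnorm d (\<lambda>m. f m + g m) \<le> L2_set (\<lambda>m. cmod (f m) + cmod (g m)) {..<d}"
    unfolding cnorm_def by (intro L2_set_mono) (auto intro: norm_triangle_ineq)
  also have "\<dots> \<le> cnorm d f + cnorm d g" unfolding cnorm_def by (rule L2_set_triangle_ineq)
  finally show ?thesis .
qed

lemma cnorm_scale: "cnorm d (\<lambda>m. c * f m) = cmod c * cnorm d f"
  by (simp add: cnorm_def norm_mult L2_set_right_distrib)

lemma cnorm_minus_commute: "cnorm d (\<lambda>m. f m - g m) = cnorm d (\<lambda>m. g m - f m)"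
  by (simp add: cnorm_def norm_minus_commute)

lemma cnorm_sum: "finite I \<Longrightarrow> cnorm d (\<lambda>m. \<Sum>i\<in>I. c i * f i m) \<le> (\<Sum>i\<in>I. cmod (c i) * cnorm d (f i))"
proof (induction I rule: finite_induct)
  case empty
  show ?case by (simp add: cnorm_def L2_set_0')
next
  case (insert i I)
  have "cnorm d (\<lambda>m. \<Sum>i\<in>insert i I. c i * f i m) \<le> cnorm d (\<lambda>m. c i * f i m) + cnorm d (\<lambda>m. \<Sum>i\<in>I. c i * f i m)"
    using insert by (simp add: cnorm_triangle)
  then show ?case using insert by (simp add: cnorm_scale)
qed

lemma cinner_commute: "cinner d g f = cnj (cinner d f g)"
  by (simp add: cinner_def mult.commute)

lemma cinner_diff_right: "cinner d f (\<lambda>m. g m - h m) = cinner d f g - cinner d f h"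
  by (simp add: cinner_def right_diff_distrib sum_subtractf)

lemma cinner_diff_left: "cinner d (\<lambda>m. g m - h m) f = cinner d g f - cinner d h f"
  by (simp add: cinner_def left_diff_distrib sum_subtractf)

lemma cinner_scale_right: "cinner d f (\<lambda>m. c * g m) = c * cinner d f g"
  by (simp add: cinner_def sum_distrib_left mult_ac)

lemma cinner_sum_right: "cinner d f (\<lambda>m. \<Sum>i\<in>I. c i * g i m) = (\<Sum>i\<in>I. c i * cinner d f (g i))"
  by (simp add: cinner_def sum_distrib_left mult_ac) (rule sum.swap)

text \<open>Gram-Schmidt, one vector at a time, with control of the displacement. The tolerance
  \<delta> is quantified before the dimension \<open>d\<close>, so it stays valid however large the
  memory becomes.\<close>

lemma near_orthonormal:
  fixes n :: nat and \<eta> :: real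
  assumes "\<eta> > 0"
  shows "\<exists>\<delta>>0. \<forall>d f. (\<forall>i<n. \<forall>j<n. cmod (cinner d (f i) (f j) - of_bool (i = j)) \<le> \<delta>) \<longrightarrow>
    (\<exists>e. (\<forall>i<n. \<forall>j<n. cinner d (e i) (e j) = of_bool (i = j)) \<and> (\<forall>i<n. cnorm d (\<lambda>m. e i m - f i m) \<le> \<eta>))"
  using assms
proof (induction n arbitrary: \<eta>)
  case 0
  show ?case by (intro exI[of _ 1]) auto
next
  case (Suc n)
  \<comment> \<open>The cap 1/2 keeps the vector to be normalised away from 0. With
    \<open>\<eta>'\<close>, the \<open>n\<close> projections of size at most
    \<open>3 * \<eta>'\<close> sum to at most \<open>3 * \<tau> / 16\<close>, the norm is off by at
    most \<open>\<tau> / 4\<close>, and together this is less than \<tau>.\<close>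
  define \<tau> where "\<tau> = min \<eta> (1/2)"
  define \<eta>' where "\<eta>' = \<tau> / (16 * (real n + 1))"
  have \<tau>: "0 < \<tau>" "\<tau> \<le> \<eta>" "\<tau> \<le> 1/2" using Suc.prems by (auto simp: \<tau>_def)
  have \<eta>': "0 < \<eta>'" using \<tau> by (simp add: \<eta>'_def)
  have "16 * (real n + 1) * \<eta>' = \<tau>" by (simp add: \<eta>'_def)
  then have n\<eta>: "n * \<eta>' + \<eta>' = \<tau> / 16" by (simp add: algebra_simps)
  have "0 \<le> n * \<eta>'" using \<eta>' by simp
  with n\<eta> have n\<eta>_le: "n * \<eta>' \<le> \<tau> / 16" and \<eta>_le: "\<eta>' \<le> \<tau> / 16" using \<eta>' by linarith+
  obtain \<delta>' where \<delta>': "\<delta>' > 0" and IH: "\<And>d f. (\<forall>i<n. \<forall>j<n. cmod (cinner d (f i) (f j) - of_bool (i = j)) \<le> \<delta>') \<Longrightarrow>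
    (\<exists>e. (\<forall>i<n. \<forall>j<n. cinner d (e i) (e j) = of_bool (i = j)) \<and> (\<forall>i<n. cnorm d (\<lambda>m. e i m - f i m) \<le> \<eta>'))"
    using Suc.IH[OF \<eta>'] by blast
  define \<delta> where "\<delta> = min \<delta>' \<eta>'"
  have \<delta>: "\<delta> > 0" "\<delta> \<le> \<delta>'" "\<delta> \<le> \<eta>'" using \<delta>' \<eta>' by (auto simp: \<delta>_def)
  show ?case
  proof (intro exI[of _ \<delta>] conjI allI impI \<delta>(1))
    fix d :: nat and f :: "nat \<Rightarrow> nat \<Rightarrow> complex"
    assume f: "\<forall>i<Suc n. \<forall>j<Suc n. cmod (cinner d (f i) (f j) - of_bool (i = j)) \<le> \<delta>"
    then have "\<forall>i<n. \<forall>j<n. cmod (cinner d (f i) (f j) - of_bool (i = j)) \<le> \<delta>'"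
      using \<delta>(2) by (meson less_Suc_eq order_trans)
    then obtain e where e: "\<And>i j. i < n \<Longrightarrow> j < n \<Longrightarrow> cinner d (e i) (e j) = of_bool (i = j)"
      "\<And>i. i < n \<Longrightarrow> cnorm d (\<lambda>m. e i m - f i m) \<le> \<eta>'"
      using IH[of d f] by blast
    let ?F = "cnorm d (f n)"
    have "cmod (cinner d (f n) (f n) - 1) \<le> \<delta>" using f by force
    then have "\<bar>?F\<^sup>2 - 1\<bar> \<le> \<delta>"
      unfolding cinner_self by (metis norm_of_real of_real_1 of_real_diff)
    moreover have "\<bar>?F - 1\<bar> \<le> \<bar>?F\<^sup>2 - 1\<bar>"
    proof -
      have "?F\<^sup>2 - 1 = (?F - 1) * (?F + 1)" by (simp add: power2_eq_square algebra_simps)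
      then have "\<bar>?F\<^sup>2 - 1\<bar> = \<bar>?F - 1\<bar> * (?F + 1)" by (simp add: abs_mult)
      moreover have "\<bar>?F - 1\<bar> * 1 \<le> \<bar>?F - 1\<bar> * (?F + 1)" by (rule mult_left_mono) auto
      ultimately show ?thesis by simp
    qed
    ultimately have F1: "\<bar>?F - 1\<bar> \<le> \<eta>'" using \<delta>(3) by linarith
    then have F2: "?F \<le> 2" using \<eta>_le \<tau> by linarith
    define \<alpha> where "\<alpha> i = cinner d (e i) (f n)" for i
    have \<alpha>: "cmod (\<alpha> i) \<le> 3 * \<eta>'" if i: "i < n" for i
    proof -
      have "\<alpha> i = cinner d (f i) (f n) + cinner d (\<lambda>m. e i m - f i m) (f n)"
        by (simp add: \<alpha>_def cinner_diff_left)
      then have "cmod (\<alpha> i) \<le> cmod (cinner d (f i) (f n)) + cmod (cinner d (\<lambda>m. e i m - f i m) (f n))"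
        by (simp add: norm_triangle_ineq)
      moreover have "cmod (cinner d (f i) (f n) - of_bool (i = n)) \<le> \<delta>" using f i less_SucI lessI by blast
      moreover have "cmod (cinner d (\<lambda>m. e i m - f i m) (f n)) \<le> \<eta>' * 2"
        using cinner_bound[of d "\<lambda>m. e i m - f i m" "f n"] mult_mono[OF e(2)[OF i] F2] \<eta>' by simp
      ultimately show ?thesis using \<delta>(3) i by simp
    qed
    define g where "g = (\<lambda>m. f n m - (\<Sum>i<n. \<alpha> i * e i m))"
    have e1: "cnorm d (e i) = 1" if "i < n" for i
    proof -
      have "complex_of_real ((cnorm d (e i))\<^sup>2) = of_real 1" using e(1)[OF that that] by (simp add: cinner_self)
      then have "(cnorm d (e i))\<^sup>2 = 1\<^sup>2" by (simp only: of_real_eq_iff) simp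
      then show ?thesis by (rule power2_eq_imp_eq) auto
    qed
    have gf: "cnorm d (\<lambda>m. g m - f n m) \<le> 3 * \<tau> / 16"
    proof -
      have "cnorm d (\<lambda>m. g m - f n m) = cnorm d (\<lambda>m. \<Sum>i<n. \<alpha> i * e i m)"
        by (subst cnorm_minus_commute) (simp add: g_def)
      also have "\<dots> \<le> (\<Sum>i<n. cmod (\<alpha> i) * cnorm d (e i))" by (rule cnorm_sum) simp
      also have "\<dots> \<le> (\<Sum>i<n. 3 * \<eta>')" using \<alpha> e1 by (intro sum_mono) auto
      also have "\<dots> \<le> 3 * \<tau> / 16" using n\<eta>_le by (simp add: mult.commute)
      finally show ?thesis .
    qed
    let ?G = "cnorm d g"
    have "?G \<le> ?F + cnorm d (\<lambda>m. g m - f n m)" using cnorm_triangle[of d "f n" "\<lambda>m. g m - f n m"] by simp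
    moreover have "?F \<le> ?G + cnorm d (\<lambda>m. g m - f n m)"
      using cnorm_triangle[of d g "\<lambda>m. f n m - g m"] by (simp add: cnorm_minus_commute)
    ultimately have G1: "\<bar>?G - 1\<bar> \<le> \<tau> / 4" using F1 gf \<eta>_le by linarith
    then have G0: "?G > 0" using \<tau> by linarith
    define h where "h = (\<lambda>m. complex_of_real (1 / ?G) * g m)"
    have eg: "cinner d (e i) g = 0" if "i < n" for i
    proof -
      have "cinner d (e i) g = \<alpha> i - (\<Sum>k<n. \<alpha> k * cinner d (e i) (e k))"
        by (simp add: g_def cinner_diff_right cinner_sum_right \<alpha>_def)
      also have "(\<Sum>k<n. \<alpha> k * cinner d (e i) (e k)) = (\<Sum>k<n. if k = i then \<alpha> i else 0)"
        using that by (intro sum.cong refl) (auto simp: e)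
      finally show ?thesis using that by simp
    qed
    have eh: "cinner d (e i) h = 0" "cinner d h (e i) = 0" if "i < n" for i
    proof -
      show "cinner d (e i) h = 0" unfolding h_def cinner_scale_right using eg[OF that] by simp
      then show "cinner d h (e i) = 0" by (subst cinner_commute) simp
    qed
    have hh: "cinner d h h = 1"
      unfolding cinner_self unfolding h_def cnorm_scale norm_of_real using G0 by simp
    have hf: "cnorm d (\<lambda>m. h m - f n m) \<le> \<eta>"
    proof -
      have "cnorm d (\<lambda>m. h m - f n m) \<le> cnorm d (\<lambda>m. h m - g m) + cnorm d (\<lambda>m. g m - f n m)"
        using cnorm_triangle[of d "\<lambda>m. h m - g m" "\<lambda>m. g m - f n m"] by simp
      moreover have "cnorm d (\<lambda>m. h m - g m) = \<bar>?G - 1\<bar>"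
      proof -
        have "(\<lambda>m. h m - g m) = (\<lambda>m. complex_of_real (1 / ?G - 1) * g m)"
          by (simp add: h_def left_diff_distrib)
        then have "cnorm d (\<lambda>m. h m - g m) = \<bar>1 / ?G - 1\<bar> * ?G" by (simp only: cnorm_scale norm_of_real)
        also have "\<dots> = \<bar>(1 / ?G - 1) * ?G\<bar>" using G0 by (simp add: abs_mult)
        also have "(1 / ?G - 1) * ?G = 1 - ?G" using G0 by (simp add: field_simps)
        finally show ?thesis by simp
      qed
      ultimately show ?thesis using G1 gf \<tau> by linarith
    qed
    show "\<exists>e. (\<forall>i<Suc n. \<forall>j<Suc n. cinner d (e i) (e j) = of_bool (i = j)) \<and> (\<forall>i<Suc n. cnorm d (\<lambda>m. e i m - f i m) \<le> \<eta>)"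
    proof (intro exI[of _ "e(n := h)"] conjI allI impI)
      fix i j assume "i < Suc n" "j < Suc n"
      then show "cinner d ((e(n := h)) i) ((e(n := h)) j) = of_bool (i = j)"
        using e(1) eh hh by (auto simp: less_Suc_eq)
    next
      fix i assume "i < Suc n"
      moreover have "\<eta>' \<le> \<eta>" using \<eta>_le \<tau> by linarith
      ultimately show "cnorm d (\<lambda>m. (e(n := h)) i m - f i m) \<le> \<eta>"
        using e(2) hf by (auto simp: less_Suc_eq intro: order_trans)
    qed
  qed
qed

section \<open>Fidelity through the partial trace\<close>

definition mvec :: "complex mat \<Rightarrow> complex Matrix.vec \<Rightarrow> nat \<Rightarrow> complex" where
  "mvec A v x = (\<Sum>z<dim_vec v. A $$ (x, z) * v $ z)"

lemma conj_proj_entry: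
  assumes W: "W \<in> carrier_mat D D" and v: "dim_vec v = D" and xy: "x < D" "y < D"
  shows "(W * proj v * adj W) $$ (x, y) = mvec W v x * cnj (mvec W v y)"
proof -
  have P: "proj v \<in> carrier_mat D D" using v by (simp add: proj_def)
  have A: "adj W \<in> carrier_mat D D" using W by (simp add: adj_def)
  have WP: "(W * proj v) $$ (x, z) = mvec W v x * cnj (v $ z)" if "z < D" for z
    using mat_mult_entry[OF W P xy(1) that] that v by (simp add: proj_def mvec_def sum_distrib_left sum_distrib_right mult_ac)
  have "(W * proj v * adj W) $$ (x, y) = (\<Sum>z<D. (W * proj v) $$ (x, z) * adj W $$ (z, y))"
    by (rule mat_mult_entry[OF mult_carrier_mat[OF W P] A xy])
  also have "\<dots> = (\<Sum>z<D. mvec W v x * cnj (v $ z) * cnj (W $$ (y, z)))"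
    using W xy by (intro sum.cong refl) (simp add: WP adj_def)
  also have "\<dots> = mvec W v x * cnj (mvec W v y)"
    using v by (simp add: mvec_def sum_distrib_left mult_ac)
  finally show ?thesis .
qed

lemma expect_conj:
  assumes E: "E \<in> carrier_mat M K" and R: "R \<in> carrier_mat M M" and \<psi>: "dim_vec \<psi> = K"
  shows "expect (adj E * R * E) \<psi> = (\<Sum>m<M. \<Sum>m'<M. cnj (mvec E \<psi> m) * R $$ (m, m') * mvec E \<psi> m')"
proof -
  have A: "adj E \<in> carrier_mat K M" using E by (simp add: adj_def)
  have adj_entry: "adj E $$ (i, m) = cnj (E $$ (m, i))" if "i < K" "m < M" for i m
    using E that by (simp add: adj_def)
  have AR: "adj E * R \<in> carrier_mat K M" using A R by (rule mult_carrier_mat)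
  have entry: "(adj E * R * E) $$ (i, j) = (\<Sum>m<M. \<Sum>m'<M. cnj (E $$ (m, i)) * R $$ (m, m') * E $$ (m', j))"
    if ij: "i < K" "j < K" for i j
  proof -
    have "(adj E * R * E) $$ (i, j) = (\<Sum>m'<M. (adj E * R) $$ (i, m') * E $$ (m', j))"
      by (rule mat_mult_entry[OF AR E ij])
    also have "\<dots> = (\<Sum>m'<M. \<Sum>m<M. cnj (E $$ (m, i)) * R $$ (m, m') * E $$ (m', j))"
      using adj_entry[OF ij(1)] by (intro sum.cong refl) (simp add: mat_mult_entry[OF A R ij(1)] sum_distrib_right)
    finally show ?thesis by (subst sum.swap)
  qed
  have "expect (adj E * R * E) \<psi> = (\<Sum>i<K. \<Sum>j<K. \<Sum>m<M. \<Sum>m'<M.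
      cnj (\<psi> $ i) * (cnj (E $$ (m, i)) * R $$ (m, m') * E $$ (m', j)) * \<psi> $ j)"
    using \<psi> by (simp add: expect_def entry sum_distrib_left sum_distrib_right)
  also have "\<dots> = (\<Sum>m<M. \<Sum>m'<M. \<Sum>i<K. \<Sum>j<K.
      cnj (\<psi> $ i) * (cnj (E $$ (m, i)) * R $$ (m, m') * E $$ (m', j)) * \<psi> $ j)"
  proof -
    have sw: "(\<Sum>i<K. \<Sum>j<K. \<Sum>m<M. \<Sum>m'<M. F i j m m') = (\<Sum>m<M. \<Sum>m'<M. \<Sum>i<K. \<Sum>j<K. F i j m m')"
      for F :: "nat \<Rightarrow> nat \<Rightarrow> nat \<Rightarrow> nat \<Rightarrow> complex"
      by (rule trans[OF trans[OF sum.cong[OF refl sum.swap] sum.swap]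
            sum.cong[OF refl trans[OF sum.cong[OF refl sum.swap] sum.swap]]])
    show ?thesis by (rule sw)
  qed
  also have "\<dots> = (\<Sum>m<M. \<Sum>m'<M. cnj (mvec E \<psi> m) * R $$ (m, m') * mvec E \<psi> m')"
    using \<psi> by (simp add: mvec_def sum_distrib_left sum_distrib_right mult_ac)
  finally show ?thesis .
qed

text \<open>The expectation is a sum, over the final basis states of the chain, of squared overlaps
  with the memory amplitudes. Only the term of the empty chain, index 0, is kept.\<close>

lemma expect_ptrace_ge:
  assumes E: "E \<in> carrier_mat M K" and \<psi>: "dim_vec \<psi> = K" and W: "W \<in> carrier_mat (C * M) (C * M)"
    and v: "dim_vec v = C * M" and C: "0 < C"
  shows "(cmod (cinner M (mvec E \<psi>) (mvec W v)))\<^sup>2 \<le> Re (expect (adj E * ptrace_first C M (W * proj v * adj W) * E) \<psi>)"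
proof -
  let ?R = "ptrace_first C M (W * proj v * adj W)" and ?w = "mvec W v" and ?e = "mvec E \<psi>"
  have R: "?R \<in> carrier_mat M M" by (simp add: ptrace_first_def)
  have lt: "c * M + m < C * M" if "c < C" "m < M" for c m using that by (rule mult_add_less_mult)
  have entry: "?R $$ (m, m') = (\<Sum>c<C. ?w (c * M + m) * cnj (?w (c * M + m')))" if "m < M" "m' < M" for m m'
    using that lt by (simp add: ptrace_first_def conj_proj_entry[OF W v])
  have "expect (adj E * ?R * E) \<psi> = (\<Sum>m<M. \<Sum>m'<M. cnj (?e m) * ?R $$ (m, m') * ?e m')"
    by (rule expect_conj[OF E R \<psi>])
  also have "\<dots> = (\<Sum>m<M. \<Sum>m'<M. \<Sum>c<C. cnj (?e m) * (?w (c * M + m) * cnj (?w (c * M + m'))) * ?e m')"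
    by (simp add: entry sum_distrib_left sum_distrib_right)
  also have "\<dots> = (\<Sum>c<C. \<Sum>m<M. \<Sum>m'<M. cnj (?e m) * (?w (c * M + m) * cnj (?w (c * M + m'))) * ?e m')"
    by (rule trans[OF sum.cong[OF refl sum.swap] sum.swap])
  also have "\<dots> = (\<Sum>c<C. cinner M ?e (\<lambda>m. ?w (c * M + m)) * cnj (cinner M ?e (\<lambda>m. ?w (c * M + m))))"
    unfolding cinner_def cnj_sum sum_product by (intro sum.cong refl) (simp add: mult_ac)
  also have "\<dots> = of_real (\<Sum>c<C. (cmod (cinner M ?e (\<lambda>m. ?w (c * M + m))))\<^sup>2)"
    by (simp add: complex_norm_square del: of_real_power)
  finally have "Re (expect (adj E * ?R * E) \<psi>) = (\<Sum>c<C. (cmod (cinner M ?e (\<lambda>m. ?w (c * M + m))))\<^sup>2)"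
    by simp
  moreover have "(cmod (cinner M ?e (\<lambda>m. ?w (0 * M + m))))\<^sup>2 \<le> (\<Sum>c<C. (cmod (cinner M ?e (\<lambda>m. ?w (c * M + m))))\<^sup>2)"
    by (rule member_le_sum[where f = "\<lambda>c. (cmod (cinner M ?e (\<lambda>m. ?w (c * M + m))))\<^sup>2"]) (use C in auto)
  ultimately show ?thesis by simp
qed

lemma mvec_init_state:
  assumes "NA \<le> T" "dim_vec \<psi> = 2^NA"
  shows "mvec W (init_state NA T \<psi>) x = (\<Sum>i<2^NA. \<psi> $ i * W $$ (x, i * 2^(T-NA)))"
proof -
  have T: "(2::nat)^T = 2^NA * 2^(T-NA)" using assms by (simp flip: power_add)
  have "mvec W (init_state NA T \<psi>) x = (\<Sum>z<2^NA * 2^(T-NA). W $$ (x, z) * (if z mod 2^(T-NA) = 0 then \<psi> $ (z div 2^(T-NA)) else 0))"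
    unfolding mvec_def init_state_def dim_vec T by (intro sum.cong refl) simp
  also have "\<dots> = (\<Sum>i<2^NA. \<Sum>r<(2::nat)^(T-NA). if r = 0 then \<psi> $ i * W $$ (x, i * 2^(T-NA)) else 0)"
    unfolding sum_lessThan_mult by (intro sum.cong refl) auto
  also have "\<dots> = (\<Sum>i<2^NA. \<psi> $ i * W $$ (x, i * 2^(T-NA)))" by simp
  finally show ?thesis .
qed

lemma isometry_of_orthonormal:
  assumes "\<And>i j. i < K \<Longrightarrow> j < K \<Longrightarrow> cinner M (e i) (e j) = of_bool (i = j)"
  shows "isometry K M (Matrix.mat M K (\<lambda>(m, i). e i m))"
proof -
  let ?E = "Matrix.mat M K (\<lambda>(m, i). e i m)"
  have E: "?E \<in> carrier_mat M K" by simp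
  have A: "adj ?E \<in> carrier_mat K M" by (simp add: adj_def)
  have "(adj ?E * ?E) $$ (i, j) = cinner M (e i) (e j)" if "i < K" "j < K" for i j
    using mat_mult_entry[OF A E that] that by (simp add: adj_def cinner_def)
  then have "adj ?E * ?E = 1\<^sub>m K"
    using A assms by (intro eq_matI) (auto simp: adj_def)
  then show ?thesis by (simp add: isometry_def)
qed

text \<open>Bounding each coefficient by 1 costs the factor \<open>K\<close>, which is harmless:
  \<eta> may depend on \<open>K\<close>.\<close>

lemma overlap_near_isometry:
  fixes K :: nat and \<eta> :: real
  assumes on: "\<And>i j. i < K \<Longrightarrow> j < K \<Longrightarrow> cinner M (e i) (e j) = of_bool (i = j)"
    and near: "\<And>i. i < K \<Longrightarrow> cnorm M (\<lambda>m. e i m - f i m) \<le> \<eta>"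
    and unit: "(\<Sum>i<K. (cmod (c i))\<^sup>2) = 1"
  shows "1 - 2 * (K * \<eta>) \<le> (cmod (cinner M (\<lambda>m. \<Sum>i<K. c i * e i m) (\<lambda>m. \<Sum>i<K. c i * f i m)))\<^sup>2"
proof -
  let ?e = "\<lambda>m. \<Sum>i<K. c i * e i m" and ?f = "\<lambda>m. \<Sum>i<K. c i * f i m"
  have "cinner M ?e ?e = (\<Sum>i<K. c i * cinner M ?e (e i))" by (rule cinner_sum_right)
  also have "\<dots> = (\<Sum>i<K. c i * cnj (c i))"
  proof (intro sum.cong refl)
    fix i assume "i \<in> {..<K}"
    then have i: "i < K" by simp
    have "cinner M (e i) ?e = (\<Sum>j<K. c j * cinner M (e i) (e j))" by (rule cinner_sum_right)
    also have "\<dots> = (\<Sum>j<K. if j = i then c i else 0)" using i by (intro sum.cong refl) (auto simp: on)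
    also have "\<dots> = c i" using i by simp
    finally show "c i * cinner M ?e (e i) = c i * cnj (c i)" by (subst cinner_commute) simp
  qed
  also have "\<dots> = of_real (\<Sum>i<K. (cmod (c i))\<^sup>2)" by (simp add: complex_norm_square del: of_real_power)
  finally have ee: "cinner M ?e ?e = 1" using unit by simp
  then have "complex_of_real ((cnorm M ?e)\<^sup>2) = of_real 1" by (simp add: cinner_self)
  then have "(cnorm M ?e)\<^sup>2 = 1\<^sup>2" by (simp only: of_real_eq_iff) simp
  then have e1: "cnorm M ?e = 1" by (rule power2_eq_imp_eq) auto
  have c1: "cmod (c i) \<le> 1" if "i < K" for i
  proof -
    have "(cmod (c i))\<^sup>2 \<le> 1" unfolding unit[symmetric] by (rule member_le_sum) (use that in auto)
    then show ?thesis using power2_le_imp_le[of "cmod (c i)" 1] by simp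
  qed
  have "cnorm M (\<lambda>m. ?e m - ?f m) = cnorm M (\<lambda>m. \<Sum>i<K. c i * (e i m - f i m))"
    by (simp add: right_diff_distrib sum_subtractf)
  also have "\<dots> \<le> (\<Sum>i<K. cmod (c i) * cnorm M (\<lambda>m. e i m - f i m))"
    by (rule cnorm_sum[where f = "\<lambda>i m. e i m - f i m"]) simp
  also have "\<dots> \<le> (\<Sum>i<K. 1 * \<eta>)"
    using c1 near by (intro sum_mono mult_mono) auto
  finally have d: "cnorm M (\<lambda>m. ?e m - ?f m) \<le> K * \<eta>" by simp
  have "cmod (1 - cinner M ?e ?f) = cmod (cinner M ?e (\<lambda>m. ?e m - ?f m))"
    unfolding cinner_diff_right ee ..
  also have "\<dots> \<le> K * \<eta>" using cinner_bound[of M ?e "\<lambda>m. ?e m - ?f m"] d e1 by simp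
  finally have "cmod (1 - cinner M ?e ?f) \<le> K * \<eta>" .
  moreover have "1 - cmod (cinner M ?e ?f) \<le> cmod (1 - cinner M ?e ?f)"
    using norm_triangle_ineq2[of 1 "cinner M ?e ?f"] by simp
  ultimately have x: "1 - K * \<eta> \<le> cmod (cinner M ?e ?f)" by linarith
  \<comment> \<open>The tangent bound on the square needs no sign condition on
    \<open>1 - K * \<eta>\<close>.\<close>
  have "2 * cmod (cinner M ?e ?f) - 1 \<le> (cmod (cinner M ?e ?f))\<^sup>2"
    using zero_le_power2[of "cmod (cinner M ?e ?f) - 1"] by (simp add: power2_eq_square algebra_simps)
  with x show ?thesis by linarith
qed

section \<open>Emptying the chain into the memory\<close>

theorem mainTheorem1:
  fixes NA NR NB :: nat and H :: "complex mat" and \<epsilon> :: real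
  assumes "NA \<ge> 1" and "NB \<ge> 1"
    and "hermitian_mat (2^(NA+NR+NB)) H"
    and "nn_form (NA+NR+NB) H"
    and "H * Ztot (NA+NR+NB) = Ztot (NA+NR+NB) * H"
    and "\<exists>t0::real. f1N (NA+NR+NB) H t0 \<noteq> 0"
    and "\<epsilon> > 0"
  shows "\<exists>t::real. t > 0 \<and> (\<exists>L::nat. L \<ge> 1 \<and> (\<exists>E. isometry (2^NA) (2^(NB*L)) E \<and>
           (\<forall>\<psi>. is_unit_vec (2^NA) \<psi> \<longrightarrow>
              Re (expect (adj E * rhoM NA NR NB H t L \<psi> * E) \<psi>) \<ge> 1 - \<epsilon>)))"
proof -
  define N where "N = NA + NR + NB"
  have NB: "1 \<le> NB" "NB \<le> N" using assms by (auto simp: N_def)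
  have herm: "hermitian_mat (2^N) H" and nn: "nn_form N H" and comm: "H * Ztot N = Ztot N * H"
    using assms by (simp_all add: N_def)
  have H: "H \<in> carrier_mat (2^N) (2^N)" using herm by (simp add: hermitian_mat_def)
  obtain t0 where t0: "f1N N H t0 \<noteq> 0" using assms by (auto simp: N_def)
  have cons: "H $$ (x, y) = 0" if "x < 2^N" "y < 2^N" "wt x \<noteq> wt y" for x y
    using wt_conserved_if_commutes[OF H comm that] .
  obtain t where t: "t > 0" and drain: "\<And>v. v 0 = 0 \<Longrightarrow>
      (\<And>m. m \<le> N \<Longrightarrow> vanishes_on_B N NB ((app (2^N) (\<lambda>x y. evol H t $$ (x, y)) ^^ m) v)) \<Longrightarrow> \<forall>x<2^N. v x = 0"
    using evol_drains[OF NB H nn cons t0] by blast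
  define u where "u = (\<lambda>x y. evol H t $$ (x, y))"
  interpret leaky_chain N NB u
  proof
    show "u x y = 0" if "x < 2^N" "y < 2^N" "wt x \<noteq> wt y" for x y
      unfolding u_def by (rule evol_block_diagonal[where g = wt, OF H cons that])
    show "(\<Sum>x<2^N. cnj (u x y) * u x z) = of_bool (y = z)" if "y < 2^N" "z < 2^N" for y z
      unfolding u_def by (rule evol_unitary[OF herm that])
  qed (rule NB(2))
  let ?K = "2^NA :: nat"
  define \<eta> where "\<eta> = \<epsilon> / (2 * ?K)"
  have \<eta>: "\<eta> > 0" using assms by (simp add: \<eta>_def)
  obtain \<delta> where \<delta>: "\<delta> > 0" and near: "\<And>d f. (\<forall>i<?K. \<forall>j<?K. cmod (cinner d (f i) (f j) - of_bool (i = j)) \<le> \<delta>) \<Longrightarrow>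
    (\<exists>e. (\<forall>i<?K. \<forall>j<?K. cinner d (e i) (e j) = of_bool (i = j)) \<and> (\<forall>i<?K. cnorm d (\<lambda>m. e i m - f i m) \<le> \<eta>))"
    using near_orthonormal[OF \<eta>, of ?K] by blast
  \<comment> \<open>The sum of all weights is a crude bound for the excitation number of every basis
    state, so one \<open>L\<close> serves all inputs.\<close>
  obtain L where L: "L \<ge> 1" and small: "\<And>v. vanishes_on_B N NB v \<Longrightarrow>
      exc (2^N) v \<le> real (\<Sum>x<2^N. wt x) \<Longrightarrow> resid N NB u L v \<le> \<delta>"
    using resid_small[OF drain[folded u_def] \<delta>, where C = "real (\<Sum>x<2^N. wt x)"] by blast
  let ?M = "2^(NB*L) :: nat"
  define T where "T = N + NB*L"
  have T: "(2::nat)^T = 2^N * ?M" by (simp add: T_def power_add)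
  define W where "W = Wop N NB L H t"
  have W: "W \<in> carrier_mat (2^N * ?M) (2^N * ?M)"
    unfolding W_def T[symmetric] T_def by (rule Wop_carrier[OF H])
  define c0 where "c0 i = i * 2^(N-NA)" for i :: nat
  have c0: "c0 i < 2^N" if "i < ?K" for i
    using mult_add_less_mult[OF that, of 0 "2^(N-NA)"] by (simp add: c0_def N_def add.assoc flip: power_add)
  have c0_inj: "c0 i = c0 j \<longleftrightarrow> i = j" for i j by (simp add: c0_def)
  define b where "b i = (\<lambda>x. of_bool (x = c0 i) :: complex)" for i
  \<comment> \<open>The amplitude, for input \<open>i\<close>, of finding the chain in
    \<open>c\<close> and the memory in \<open>m\<close> at the end; \<open>c = 0\<close> is the
    emptied chain.\<close>
  define \<phi> where "\<phi> i c m = kstr N NB u (b i) L m c" for i c m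
  have W_entry: "W $$ (c * ?M + m, i * 2^(T-NA)) = \<phi> i c m" if "i < ?K" "c < 2^N" "m < ?M" for i c m
  proof -
    have "T - NA = (N - NA) + NB*L" by (simp add: T_def N_def)
    then have "i * 2^(T-NA) = c0 i * ?M" by (simp add: c0_def power_add)
    then show ?thesis
      using Wop_column[OF NB(2) H c0[OF that(1)] that(2,3), of t] by (simp add: W_def \<phi>_def u_def b_def)
  qed
  have b_inner: "(\<Sum>x<2^N. cnj (b i x) * b j x) = of_bool (i = j)" if "i < ?K" "j < ?K" for i j
  proof -
    have "(\<Sum>x<2^N. cnj (b i x) * b j x) = (\<Sum>x<2^N. if x = c0 i then of_bool (i = j) else 0)"
      by (intro sum.cong refl) (auto simp: b_def c0_inj)
    then show ?thesis using c0[OF that(1)] by simp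
  qed
  have \<phi>_resid: "(\<Sum>m<?M. exc (2^N) (\<lambda>c. \<phi> i c m)) \<le> \<delta>" if i: "i < ?K" for i
  proof -
    have "2^NB dvd c0 i" unfolding c0_def by (intro dvd_mult le_imp_power_dvd) (simp add: N_def)
    then have "vanishes_on_B N NB (b i)"
      by (auto simp: vanishes_on_B_def b_def)
    moreover have "exc (2^N) (b i) \<le> real (\<Sum>x<2^N. wt x)"
      unfolding exc_def of_nat_sum by (intro sum_mono) (auto simp: b_def)
    ultimately show ?thesis using small[of "b i"] by (simp add: \<phi>_def flip: sum_exc_kstr)
  qed
  \<comment> \<open>Summed over all \<open>c\<close> the Gram matrix is the identity. The omitted
    terms have \<open>c\<close> of weight at least 1, so by the inequality of arithmetic and
    geometric means they are bounded by the mean of the two residuals.\<close>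
  have gram: "cmod (cinner ?M (\<phi> i 0) (\<phi> j 0) - of_bool (i = j)) \<le> \<delta>" if ij: "i < ?K" "j < ?K" for i j
  proof -
    let ?g = "\<lambda>m c. cnj (\<phi> i c m) * \<phi> j c m"
    have split: "(\<Sum>c<2^N. h c) = h 0 + (\<Sum>c\<in>{1..<2^N}. h c)" for h :: "nat \<Rightarrow> complex"
      by (simp add: lessThan_atLeast0 sum.atLeast_Suc_lessThan)
    have "of_bool (i = j) = (\<Sum>m<?M. \<Sum>c<2^N. ?g m c)"
      using sum_inner_kstr[of "b i" L "b j"] b_inner[OF ij] by (simp add: \<phi>_def)
    also have "\<dots> = cinner ?M (\<phi> i 0) (\<phi> j 0) + (\<Sum>m<?M. \<Sum>c\<in>{1..<2^N}. ?g m c)"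
      unfolding split sum.distrib by (simp add: cinner_def)
    finally have "cmod (cinner ?M (\<phi> i 0) (\<phi> j 0) - of_bool (i = j)) = cmod (\<Sum>m<?M. \<Sum>c\<in>{1..<2^N}. ?g m c)"
      by (simp add: norm_minus_commute)
    also have "\<dots> \<le> (\<Sum>m<?M. \<Sum>c\<in>{1..<2^N}. wt c * ((cmod (\<phi> i c m))\<^sup>2 + (cmod (\<phi> j c m))\<^sup>2) / 2)"
    proof (intro sum_norm_le)
      fix m c :: nat assume "c \<in> {1..<2^N}"
      then have "1 \<le> wt c" using wt_eq_0_iff[of c] by (simp add: Suc_le_eq del: wt_eq_0_iff)
      have "2 * (cmod (\<phi> i c m) * cmod (\<phi> j c m)) \<le> (cmod (\<phi> i c m))\<^sup>2 + (cmod (\<phi> j c m))\<^sup>2"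
        using sum_squares_bound[of "cmod (\<phi> i c m)" "cmod (\<phi> j c m)"] by (simp add: mult.assoc)
      also have "\<dots> \<le> wt c * ((cmod (\<phi> i c m))\<^sup>2 + (cmod (\<phi> j c m))\<^sup>2)"
        using \<open>1 \<le> wt c\<close> mult_right_mono[of 1 "real (wt c)" "(cmod (\<phi> i c m))\<^sup>2 + (cmod (\<phi> j c m))\<^sup>2"] by simp
      finally show "cmod (?g m c) \<le> wt c * ((cmod (\<phi> i c m))\<^sup>2 + (cmod (\<phi> j c m))\<^sup>2) / 2"
        by (simp add: norm_mult)
    qed
    also have "\<dots> \<le> (\<Sum>m<?M. \<Sum>c<2^N. wt c * ((cmod (\<phi> i c m))\<^sup>2 + (cmod (\<phi> j c m))\<^sup>2) / 2)"
      by (intro sum_mono sum_mono2) auto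
    also have "\<dots> = ((\<Sum>m<?M. exc (2^N) (\<lambda>c. \<phi> i c m)) + (\<Sum>m<?M. exc (2^N) (\<lambda>c. \<phi> j c m))) / 2"
      unfolding exc_def by (simp add: sum.distrib add_divide_distrib distrib_left flip: sum_divide_distrib)
    also have "\<dots> \<le> \<delta>" using \<phi>_resid[OF ij(1)] \<phi>_resid[OF ij(2)] by simp
    finally show ?thesis .
  qed
  then obtain e where e: "\<And>i j. i < ?K \<Longrightarrow> j < ?K \<Longrightarrow> cinner ?M (e i) (e j) = of_bool (i = j)"
    "\<And>i. i < ?K \<Longrightarrow> cnorm ?M (\<lambda>m. e i m - \<phi> i 0 m) \<le> \<eta>"
    using near[of ?M "\<lambda>i. \<phi> i 0"] by blast
  define E where "E = Matrix.mat ?M ?K (\<lambda>(m, i). e i m)"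
  have iso: "isometry ?K ?M E" unfolding E_def by (rule isometry_of_orthonormal) (rule e(1))
  have "1 - \<epsilon> \<le> Re (expect (adj E * rhoM NA NR NB H t L \<psi> * E) \<psi>)" if \<psi>: "is_unit_vec ?K \<psi>" for \<psi>
  proof -
    have dim: "dim_vec \<psi> = ?K" and unit: "(\<Sum>i<?K. (cmod (\<psi> $ i))\<^sup>2) = 1"
      using \<psi> by (auto simp: is_unit_vec_def)
    let ?v = "init_state NA T \<psi>"
    have "1 - \<epsilon> = 1 - 2 * (?K * \<eta>)" by (simp add: \<eta>_def)
    also have "\<dots> \<le> (cmod (cinner ?M (\<lambda>m. \<Sum>i<?K. \<psi> $ i * e i m) (\<lambda>m. \<Sum>i<?K. \<psi> $ i * \<phi> i 0 m)))\<^sup>2"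
      by (rule overlap_near_isometry[OF e unit])
    also have "cinner ?M (\<lambda>m. \<Sum>i<?K. \<psi> $ i * e i m) (\<lambda>m. \<Sum>i<?K. \<psi> $ i * \<phi> i 0 m) = cinner ?M (mvec E \<psi>) (mvec W ?v)"
      unfolding cinner_def
    proof (intro sum.cong refl)
      fix m assume "m \<in> {..<?M}"
      then have m: "m < ?M" by simp
      have "NA \<le> T" by (simp add: T_def N_def)
      then have "mvec W ?v m = (\<Sum>i<?K. \<psi> $ i * W $$ (m, i * 2^(T-NA)))" using dim by (rule mvec_init_state)
      also have "\<dots> = (\<Sum>i<?K. \<psi> $ i * \<phi> i 0 m)" using W_entry[of _ 0 m] m by simp
      finally have Wv: "mvec W ?v m = (\<Sum>i<?K. \<psi> $ i * \<phi> i 0 m)" .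
      have "mvec E \<psi> m = (\<Sum>i<?K. \<psi> $ i * e i m)" using dim m by (simp add: mvec_def E_def mult.commute)
      with Wv show "cnj (\<Sum>i<?K. \<psi> $ i * e i m) * (\<Sum>i<?K. \<psi> $ i * \<phi> i 0 m) = cnj (mvec E \<psi> m) * mvec W ?v m"
        by simp
    qed
    also have "(cmod (cinner ?M (mvec E \<psi>) (mvec W ?v)))\<^sup>2
        \<le> Re (expect (adj E * ptrace_first (2^N) ?M (W * proj ?v * adj W) * E) \<psi>)"
      by (rule expect_ptrace_ge[OF _ dim W]) (simp_all add: E_def init_state_def T)
    also have "ptrace_first (2^N) ?M (W * proj ?v * adj W) = rhoM NA NR NB H t L \<psi>"
      by (simp add: rhoM_def Let_def N_def W_def T_def)
    finally show ?thesis .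
  qed
  with t L iso show ?thesis by blast
qed

end
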